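(* Let $\mathcal C$ be the set of strata $\mathring C(\Psi)$ of $\bar{\mathfrak h}$, $\Psi$ ranging over all $k$-step good root subsystems of $\Phi$, $0\le k\le r$, partially ordered by $C\le C'$ iff $C$ is contained in the closure of $C'$, with rank function $\operatorname{rk}(C)=\dim C$. Let $L(\mathcal A)$ be the intersection lattice of the Coxeter arrangement, ordered by reverse inclusion with rank function $\operatorname{rk}(X)=\operatorname{codim}_{\mathfrak h}X$. Then the map $G:\mathcal C\to L(\mathcal A)$, $\mathring C(\Psi)\mapsto\Psi^\perp:=\{h\in\mathfrak h:\lambda(h)=0\ \forall\lambda\in\Psi\}$, is a $W$-equivariant isomorphism of ranked posets, with inverse $F:L(\mathcal A)\to\mathcal C$, $X\mapsto\mathring C(X^\perp\cap\Phi)$, where $X^\perp\subseteq\mathfrak h^*$ is the annihilator of $X$. Here $W$ acts on $\mathcal C$ through its action on $\bar{\mathfrak h}$, which satisfies $w\cdot\mathring C(\Psi)=\mathring C(w\Psi)$, and on $L(\mathcal A)$ through its action on $\mathfrak h$.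
   Context: Let $\mathfrak g$ be a complex semisimple Lie algebra, $\mathfrak h$ a Cartan subalgebra, $r=\dim\mathfrak h$, $\Phi\subset\mathfrak h^*$ its root system, $\Phi^+$ a fixed set of positive roots, $d=|\Phi^+|$, $W$ the Weyl group. Identify $\mathbb C$ with $\{[x_0:x_1]:x_0\ne0\}\subset\mathbb P^1$ via $c\mapsto[1:c]$, $\infty=[0:1]$; points of $(\mathbb P^1)^d$ are $x=(x_\lambda)_{\lambda\in\Phi^+}$, and we set $x_{-\lambda}:=-x_\lambda$ (with $-\infty=\infty$). Identify $\mathfrak h$ with its image under $h\mapsto(\lambda(h))_{\lambda\in\Phi^+}\in\mathbb C^d\subset(\mathbb P^1)^d$; $\bar{\mathfrak h}$ is the Zariski closure of $\mathfrak h$ in $(\mathbb P^1)^d$. $W$ acts on $\bar{\mathfrak h}$ by $(w\cdot x)_\lambda=x_{w^{-1}\lambda}$, extending its action on $\mathfrak h$. A root subsystem $\Psi\subseteq\Phi$ is closed if $\lambda,\mu\in\Psi$, $\lambda+\mu\in\Phi$ imply $\lambda+\mu\in\Psi$; $\operatorname{rk}\Psi=\dim\operatorname{Span}\Psi$. A good root subsystem of a root system $\Theta$ of rank $m$ is a closed root subsystem of rank $m-1$ maximal under inclusion among closed root subsystems of rank $m-1$; the $0$-step good root subsystem of $\Phi$ is $\Phi$, and a $k$-step good root subsystem is a good root subsystem of a $(k-1)$-step one. For a closed root subsystem $\Psi$ with $\Psi^+=\Psi\cap\Phi^+$, $\mathring C(\Psi)$ is the set of $x$ with $x_\lambda=\infty$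 for $\lambda\in\Phi^+\setminus\Psi$ and $(x_\lambda)_{\lambda\in\Psi^+}=(\lambda(h))_{\lambda\in\Psi^+}$ for some $h\in\mathfrak h$. The Coxeter arrangement $\mathcal A$ consists of the hyperplanes $\lambda^\perp=\{h\in\mathfrak h:\lambda(h)=0\}$, $\lambda\in\Phi^+$, and its intersection lattice is $L(\mathcal A)=\{\bigcap_{\lambda\in S}\lambda^\perp: S\subseteq\Phi^+\}$ (the empty intersection being $\mathfrak h$). *)

theory Defs
  imports "HOL-Analysis.Analysis"
begin

text \<open>The dual of the Cartan subalgebra is modelled by real^'n (the real span of the roots,
with a W-invariant inner product made standard); the Cartan subalgebra h is complex^'n and a
root lam acts on h by lam(h) = sum_i lam_i h_i.\<close>

definition refl :: "real^'n \<Rightarrow> real^'n \<Rightarrow> real^'n" where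
  "refl a v = v - (2 * (v \<bullet> a) / (a \<bullet> a)) *\<^sub>R a"

definition root_system :: "(real^'n) set \<Rightarrow> bool" where
  "root_system Phi \<longleftrightarrow> finite Phi \<and> 0 \<notin> Phi \<and> span Phi = UNIV
     \<and> (\<forall>a\<in>Phi. \<forall>b\<in>Phi. refl a b \<in> Phi)
     \<and> (\<forall>a\<in>Phi. \<forall>b\<in>Phi. 2 * (b \<bullet> a) / (a \<bullet> a) \<in> \<int>)
     \<and> (\<forall>a\<in>Phi. \<forall>c::real. c *\<^sub>R a \<in> Phi \<longrightarrow> c = 1 \<or> c = -1)"

definition positive_system :: "(real^'n) set \<Rightarrow> (real^'n) set \<Rightarrow> bool" where
  "positive_system Phi P \<longleftrightarrow>
     (\<exists>v. (\<forall>a\<in>Phi. v \<bullet> a \<noteq> 0) \<and> P = {a\<in>Phi. 0 < v \<bullet> a})"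

definition ev :: "real^'n \<Rightarrow> complex^'n \<Rightarrow> complex" where
  "ev lam h = (\<Sum>i\<in>UNIV. complex_of_real (lam $ i) * h $ i)"

inductive_set weyl :: "(real^'n) set \<Rightarrow> (real^'n \<Rightarrow> real^'n) set" for Phi where
  weyl_id: "id \<in> weyl Phi"
| weyl_step: "w \<in> weyl Phi \<Longrightarrow> a \<in> Phi \<Longrightarrow> refl a \<circ> w \<in> weyl Phi"

text \<open>Action of W on h (complexification of the linear map w).\<close>
definition hact :: "(real^'n \<Rightarrow> real^'n) \<Rightarrow> complex^'n \<Rightarrow> complex^'n" where
  "hact w h = (\<chi> i. \<Sum>j\<in>UNIV. complex_of_real ((w (axis j 1)) $ i) * h $ j)"

definition rk :: "(real^'n) set \<Rightarrow> nat" where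
  "rk Psi = dim (span Psi)"

definition closed_subsystem :: "(real^'n) set \<Rightarrow> (real^'n) set \<Rightarrow> bool" where
  "closed_subsystem Phi Psi \<longleftrightarrow> Psi \<subseteq> Phi
     \<and> (\<forall>a\<in>Psi. \<forall>b\<in>Psi. refl a b \<in> Psi)
     \<and> (\<forall>a\<in>Psi. \<forall>b\<in>Psi. a + b \<in> Phi \<longrightarrow> a + b \<in> Psi)"

definition good_subsystem :: "(real^'n) set \<Rightarrow> (real^'n) set \<Rightarrow> (real^'n) set \<Rightarrow> bool" where
  "good_subsystem Phi Theta Psi \<longleftrightarrow> rk Theta \<ge> 1 \<and>
     Psi \<subseteq> Theta \<and> closed_subsystem Phi Psi \<and> rk Psi = rk Theta - 1 \<and>
     (\<forall>Psi'. Psi \<subseteq> Psi' \<and> Psi' \<subseteq> Theta \<and> closed_subsystem Phi Psi' \<and> rk Psi' = rk Theta - 1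
        \<longrightarrow> Psi' = Psi)"

fun kstep_good :: "(real^'n) set \<Rightarrow> nat \<Rightarrow> (real^'n) set set" where
  "kstep_good Phi 0 = {Phi}"
| "kstep_good Phi (Suc k) = {Psi. \<exists>Theta\<in>kstep_good Phi k. good_subsystem Phi Theta Psi}"

text \<open>A point of P^1 is a complex option: Some c = [1:c], None = infinity = [0:1].
A point of (P^1)^I is a function I-indexed, equal to None outside I.\<close>

definition hc :: "complex option \<Rightarrow> complex \<times> complex" where
  "hc z = (case z of None \<Rightarrow> (0, 1) | Some c \<Rightarrow> (1, c))"

definition pts :: "'i set \<Rightarrow> ('i \<Rightarrow> complex option) set" where
  "pts I = {x. \<forall>i. i \<notin> I \<longrightarrow> x i = None}"

text \<open>Multihomogeneous polynomial in homogeneous coordinates (x_{i,0}, x_{i,1}), i in I: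
coefficient function on exponent vectors, with multidegree e.\<close>
definition multihom :: "'i set \<Rightarrow> (('i \<Rightarrow> nat \<times> nat) \<Rightarrow> complex) \<Rightarrow> ('i \<Rightarrow> nat) \<Rightarrow> bool" where
  "multihom I cf e \<longleftrightarrow> finite {m. cf m \<noteq> 0} \<and>
     (\<forall>m. cf m \<noteq> 0 \<longrightarrow> (\<forall>i\<in>I. fst (m i) + snd (m i) = e i) \<and> (\<forall>i. i \<notin> I \<longrightarrow> m i = (0, 0)))"

definition peval :: "'i set \<Rightarrow> (('i \<Rightarrow> nat \<times> nat) \<Rightarrow> complex) \<Rightarrow> ('i \<Rightarrow> complex option) \<Rightarrow> complex" where
  "peval I cf x = (\<Sum>m\<in>{m. cf m \<noteq> 0}.
      cf m * (\<Prod>i\<in>I. fst (hc (x i)) ^ fst (m i) * snd (hc (x i)) ^ snd (m i)))"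

definition zariski_closed :: "'i set \<Rightarrow> ('i \<Rightarrow> complex option) set \<Rightarrow> bool" where
  "zariski_closed I S \<longleftrightarrow> (\<exists>F. (\<forall>(cf, e)\<in>F. multihom I cf e) \<and>
      S = {x \<in> pts I. \<forall>(cf, e)\<in>F. peval I cf x = 0})"

definition zariski_closure :: "'i set \<Rightarrow> ('i \<Rightarrow> complex option) set \<Rightarrow> ('i \<Rightarrow> complex option) set" where
  "zariski_closure I A = \<Inter> {S. zariski_closed I S \<and> A \<subseteq> S}"

definition zariski_irreducible :: "'i set \<Rightarrow> ('i \<Rightarrow> complex option) set \<Rightarrow> bool" where
  "zariski_irreducible I Z \<longleftrightarrow> Z \<noteq> {} \<and>
     (\<forall>Z1 Z2. zariski_closed I Z1 \<and> zariski_closed I Z2 \<and> Z \<subseteq> Z1 \<union> Z2 \<longrightarrow> Z \<subseteq> Z1 \<or> Z \<subseteq> Z2)"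

definition zariski_dim :: "'i set \<Rightarrow> ('i \<Rightarrow> complex option) set \<Rightarrow> nat" where
  "zariski_dim I A = Sup {n. \<exists>Z :: nat \<Rightarrow> ('i \<Rightarrow> complex option) set.
      (\<forall>k\<le>n. zariski_closed I (Z k) \<and> zariski_irreducible I (Z k) \<and> Z k \<subseteq> zariski_closure I A)
      \<and> (\<forall>k<n. Z k \<subset> Z (Suc k))}"

definition emb :: "(real^'n) set \<Rightarrow> complex^'n \<Rightarrow> (real^'n \<Rightarrow> complex option)" where
  "emb P h = (\<lambda>lam. if lam \<in> P then Some (ev lam h) else None)"

definition hbar :: "(real^'n) set \<Rightarrow> (real^'n \<Rightarrow> complex option) set" where
  "hbar P = zariski_closure P (range (emb P))"

definition xval :: "(real^'n) set \<Rightarrow> (real^'n \<Rightarrow> complex option) \<Rightarrow> real^'n \<Rightarrow> complex option" where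
  "xval P x mu = (if mu \<in> P then x mu else map_option uminus (x (- mu)))"

definition wact :: "(real^'n) set \<Rightarrow> (real^'n \<Rightarrow> real^'n) \<Rightarrow> (real^'n \<Rightarrow> complex option)
    \<Rightarrow> (real^'n \<Rightarrow> complex option)" where
  "wact P w x = (\<lambda>lam. if lam \<in> P then xval P x (inv w lam) else None)"

definition stratum :: "(real^'n) set \<Rightarrow> (real^'n) set \<Rightarrow> (real^'n \<Rightarrow> complex option) set" where
  "stratum P Psi = {x \<in> pts P. (\<forall>lam\<in>P - Psi. x lam = None) \<and>
       (\<exists>h. \<forall>lam\<in>P \<inter> Psi. x lam = Some (ev lam h))}"

definition strata :: "(real^'n::finite) set \<Rightarrow> (real^'n) set \<Rightarrow> (real^'n \<Rightarrow> complex option) set set" where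
  "strata Phi P = {stratum P Psi | Psi k. k \<le> CARD('n) \<and> Psi \<in> kstep_good Phi k}"

definition perp :: "(real^'n) set \<Rightarrow> (complex^'n) set" where
  "perp Psi = {h. \<forall>lam\<in>Psi. ev lam h = 0}"

definition intersection_lattice :: "(real^'n) set \<Rightarrow> (complex^'n) set set" where
  "intersection_lattice P = {\<Inter> ((\<lambda>lam. {h. ev lam h = 0}) ` S) | S. S \<subseteq> P}"

definition annihilator_roots :: "(real^'n) set \<Rightarrow> (complex^'n) set \<Rightarrow> (real^'n) set" where
  "annihilator_roots Phi X = {lam \<in> Phi. \<forall>h\<in>X. ev lam h = 0}"

definition codim :: "(complex^'n::finite) set \<Rightarrow> nat" where
  "codim X = CARD('n) - vec.dim X"

end

theory Submission
  imports Defs "HOL-Computational_Algebra.Polynomial" "HOL-Library.Function_Algebras"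
begin

text \<open>The \<open>k\<close>-step good root subsystems are exactly the flats \<open>Phi \<inter> U\<close>, \<open>U\<close> a subspace spanned by
roots, of rank \<open>r - k\<close>; they correspond to the intersections \<open>perp Psi\<close> by real linear duality.
The stratum of a flat \<open>Psi\<close> lies in the closure of the stratum of a larger flat \<open>Psi'\<close> because, for
\<open>t\<close> generic in \<open>perp Psi\<close>, the point of the latter given by \<open>h + s t\<close> tends to the point of the
former given by \<open>h\<close> as \<open>s\<close> tends to infinity.

For the dimension, a flag of flats gives a chain of irreducible closed sets of length \<open>rk Psi\<close>.
Conversely, given a chain \<open>Z 0 \<subset> \<dots> \<subset> Z n\<close> in the closure of a stratum, choose \<open>f i\<close> vanishing on
\<open>Z (i - 1)\<close> but not on \<open>Z i\<close>, and \<open>g i\<close> of the same multidegree not vanishing on \<open>Z 0\<close>. By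
irreducibility the \<open>(K + 1) ^ n\<close> products of the \<open>f i ^ a i * g i ^ (K - a i)\<close>, \<open>a i \<le> K\<close>, are linearly
independent on \<open>Z n\<close>, while on the stratum they restrict to polynomials in \<open>rk Psi\<close> variables of degree
linear in \<open>K\<close>. Letting \<open>K\<close> grow gives \<open>n \<le> rk Psi\<close>.\<close>

section \<open>Multihomogeneous functions and Zariski closure\<close>

definition mono_fun :: "'i set \<Rightarrow> ('i \<Rightarrow> nat \<times> nat) \<Rightarrow> ('i \<Rightarrow> complex option) \<Rightarrow> complex" where
  "mono_fun I m x = (\<Prod>i\<in>I. fst (hc (x i)) ^ fst (m i) * snd (hc (x i)) ^ snd (m i))"

definition has_multideg :: "'i set \<Rightarrow> ('i \<Rightarrow> nat) \<Rightarrow> ('i \<Rightarrow> nat \<times> nat) \<Rightarrow> bool" where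
  "has_multideg I e m \<longleftrightarrow> (\<forall>i\<in>I. fst (m i) + snd (m i) = e i) \<and> (\<forall>i. i \<notin> I \<longrightarrow> m i = (0, 0))"

text \<open>Multihomogeneous polynomials are treated as functions of the point, evaluated at the
  representative \<open>hc\<close>. Forgetting the coefficients lets closure properties be proved by
  adding one monomial at a time.\<close>

definition mhom :: "'i set \<Rightarrow> ('i \<Rightarrow> nat) \<Rightarrow> (('i \<Rightarrow> complex option) \<Rightarrow> complex) set" where
  "mhom I e = {peval I cf | cf. multihom I cf e}"

lemma multihom_iff:
  "multihom I cf e \<longleftrightarrow> finite {m. cf m \<noteq> 0} \<and> (\<forall>m. cf m \<noteq> 0 \<longrightarrow> has_multideg I e m)"
  by (simp add: multihom_def has_multideg_def)

lemma peval_eq_sum: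
  assumes "finite A" "{m. cf m \<noteq> 0} \<subseteq> A"
  shows "peval I cf x = (\<Sum>m\<in>A. cf m * mono_fun I m x)"
  unfolding peval_def mono_fun_def[symmetric]
  by (rule sum.mono_neutral_left) (use assms in auto)

lemma mhom_add_monomial:
  assumes "f \<in> mhom I e" "has_multideg I e m"
  shows "(\<lambda>x. f x + c * mono_fun I m x) \<in> mhom I e"
proof -
  obtain cf where f: "f = peval I cf" and cf: "multihom I cf e"
    using assms(1) by (auto simp: mhom_def)
  define A where "A = insert m {m. cf m \<noteq> 0}"
  define cf' where "cf' = cf(m := cf m + c)"
  have fin: "finite A" using cf by (simp add: A_def multihom_iff)
  have sub: "{m. cf' m \<noteq> 0} \<subseteq> A" by (auto simp: A_def cf'_def)
  have "multihom I cf' e"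
    using cf assms(2) finite_subset[OF sub fin] by (auto simp: multihom_iff cf'_def)
  moreover have "peval I cf' x = f x + c * mono_fun I m x" for x
  proof -
    have "peval I cf' x = (\<Sum>k\<in>A. cf k * mono_fun I k x + (if k = m then c * mono_fun I m x else 0))"
      unfolding peval_eq_sum[OF fin sub]
      by (rule sum.cong) (auto simp: cf'_def algebra_simps)
    also have "\<dots> = (\<Sum>k\<in>A. cf k * mono_fun I k x) + c * mono_fun I m x"
      using fin by (simp add: sum.distrib A_def)
    also have "(\<Sum>k\<in>A. cf k * mono_fun I k x) = f x"
      unfolding f by (rule peval_eq_sum[symmetric]) (use fin in \<open>auto simp: A_def\<close>)
    finally show ?thesis .
  qed
  ultimately show ?thesis by (auto simp: mhom_def intro!: exI[of _ cf'] ext)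
qed

lemma mhom_zero: "(\<lambda>x. 0) \<in> mhom I e"
  by (auto simp: mhom_def multihom_def peval_def intro!: exI[of _ "\<lambda>_. 0"])

text \<open>The monomials of a coefficient family are added one by one. Every later statement about
  restricting forms to strata thereby reduces to a single monomial, that is, to a product over the
  coordinates.\<close>

lemma mhom_induct [consumes 1, case_names zero add]:
  assumes "f \<in> mhom I e"
    and zero: "Q (\<lambda>x. 0)"
    and add: "\<And>f c m. Q f \<Longrightarrow> has_multideg I e m \<Longrightarrow> Q (\<lambda>x. f x + c * mono_fun I m x)"
  shows "Q f"
proof -
  obtain cf where f: "f = peval I cf" and cf: "multihom I cf e"
    using assms(1) by (auto simp: mhom_def)
  have "Q (\<lambda>x. \<Sum>m\<in>A. cf m * mono_fun I m x)" if "finite A" "A \<subseteq> {m. cf m \<noteq> 0}" for A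
    using that
  proof (induction A)
    case empty
    then show ?case using zero by simp
  next
    case (insert m A)
    then have "Q (\<lambda>x. (\<Sum>m\<in>A. cf m * mono_fun I m x) + cf m * mono_fun I m x)"
      using cf by (intro add) (auto simp: multihom_iff)
    with insert show ?case by (simp add: add.commute)
  qed
  moreover have "f = (\<lambda>x. \<Sum>m\<in>{m. cf m \<noteq> 0}. cf m * mono_fun I m x)"
    using cf unfolding f multihom_iff by (intro ext peval_eq_sum) auto
  ultimately show ?thesis using cf by (simp add: multihom_iff)
qed

lemma mhom_add:
  assumes "g \<in> mhom I e" "f \<in> mhom I e"
  shows "(\<lambda>x. f x + g x) \<in> mhom I e"
  using assms
proof (induction rule: mhom_induct)
  case (add g c m)
  then have "(\<lambda>x. (f x + g x) + c * mono_fun I m x) \<in> mhom I e"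
    by (intro mhom_add_monomial) auto
  then show ?case by (simp add: add.assoc)
qed auto

lemma mhom_monomial: "has_multideg I e m \<Longrightarrow> mono_fun I m \<in> mhom I e"
  using mhom_add_monomial[OF mhom_zero, of I e m 1] by simp

lemma mhom_scale: "f \<in> mhom I e \<Longrightarrow> (\<lambda>x. c * f x) \<in> mhom I e"
proof (induction rule: mhom_induct)
  case (add f d m)
  then have "(\<lambda>x. c * f x + (c * d) * mono_fun I m x) \<in> mhom I e"
    by (intro mhom_add_monomial) auto
  then show ?case by (simp add: algebra_simps)
qed (auto intro: mhom_zero)

lemma mhom_sum:
  assumes "\<And>j. j \<in> J \<Longrightarrow> f j \<in> mhom I e"
  shows "(\<lambda>x. \<Sum>j\<in>J. f j x) \<in> mhom I e"
  using assms
proof (induction J rule: infinite_finite_induct)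
  case (insert j J)
  then have "(\<lambda>x. f j x + (\<Sum>j\<in>J. f j x)) \<in> mhom I e"
    by (intro mhom_add) auto
  with insert show ?case by simp
qed (simp_all add: mhom_zero)

lemma mono_fun_mult:
  "mono_fun I m x * mono_fun I m' x
    = mono_fun I (\<lambda>i. (fst (m i) + fst (m' i), snd (m i) + snd (m' i))) x"
  unfolding mono_fun_def prod.distrib[symmetric]
  by (rule prod.cong) (simp_all add: power_add mult_ac)

lemma mhom_mult:
  assumes "g \<in> mhom I e'" "f \<in> mhom I e"
  shows "(\<lambda>x. f x * g x) \<in> mhom I (\<lambda>i. e i + e' i)"
proof -
  \<comment> \<open>Bilinearity: one factor is first taken to be a single monomial, and induction on
    that factor then gives the general product.\<close>
  have mono: "(\<lambda>x. f x * mono_fun I m' x) \<in> mhom I (\<lambda>i. e i + e' i)"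
    if "has_multideg I e' m'" for m'
    using assms(2)
  proof (induction rule: mhom_induct)
    case (add f c m)
    let ?m = "\<lambda>i. (fst (m i) + fst (m' i), snd (m i) + snd (m' i))"
    have "has_multideg I (\<lambda>i. e i + e' i) ?m"
      unfolding has_multideg_def
    proof (intro conjI ballI allI impI)
      fix i assume "i \<in> I"
      then have "fst (m i) + snd (m i) = e i" "fst (m' i) + snd (m' i) = e' i"
        using add(2) that by (auto simp: has_multideg_def)
      then show "fst (?m i) + snd (?m i) = e i + e' i" by simp
    qed (use add(2) that in \<open>auto simp: has_multideg_def\<close>)
    from mhom_add_monomial[OF add(1) this, of c] show ?case
      unfolding mono_fun_mult[of I m _ m', symmetric] by (simp add: algebra_simps)
  qed (auto intro: mhom_zero)
  from assms(1) show ?thesis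
  proof (induction rule: mhom_induct)
    case (add g c m)
    have "(\<lambda>x. f x * g x + c * (f x * mono_fun I m x)) \<in> mhom I (\<lambda>i. e i + e' i)"
      using add by (intro mhom_add mhom_scale mono)
    then show ?case by (simp add: algebra_simps)
  qed (auto intro: mhom_zero)
qed

lemma mhom_one: "(\<lambda>x. 1) \<in> mhom I (\<lambda>i. 0)"
  using mhom_monomial[of I "\<lambda>i. 0" "\<lambda>i. (0, 0)"]
  by (simp add: has_multideg_def mono_fun_def[abs_def])

lemma mhom_power: "f \<in> mhom I e \<Longrightarrow> (\<lambda>x. f x ^ k) \<in> mhom I (\<lambda>i. k * e i)"
proof (induction k)
  case (Suc k)
  from mhom_mult[OF Suc.IH[OF Suc.prems] Suc.prems] show ?case by simp
qed (simp add: mhom_one)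

text \<open>At each \<open>i\<close> the power \<open>e i\<close> of a homogeneous coordinate equal
  to 1 at \<open>x\<close> is taken: the second at infinity, the first elsewhere. This supplies, for
  any form, a partner of the same multidegree that does not vanish at \<open>x\<close>.\<close>

lemma pts_separation:
  assumes "x \<in> pts I"
  shows "\<exists>g \<in> mhom I e. g x \<noteq> 0"
proof
  let ?m = "\<lambda>i. if i \<notin> I then (0, 0) else if x i = None then (0, e i) else (e i, 0)"
  show "mono_fun I ?m \<in> mhom I e"
    by (rule mhom_monomial) (auto simp: has_multideg_def)
  have "mono_fun I ?m x = (\<Prod>i\<in>I. 1)"
    unfolding mono_fun_def by (rule prod.cong) (auto simp: hc_def split: option.splits)
  then show "mono_fun I ?m x \<noteq> 0" by simp
qed

text \<open>The form is the first homogeneous coordinate at \<open>i\<close>; it makes being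
  infinite in one coordinate a closed condition.\<close>

lemma infinity_mhom:
  assumes "finite I" "i \<in> I"
  shows "\<exists>e. \<exists>f \<in> mhom I e. \<forall>x. f x = 0 \<longleftrightarrow> x i = None"
proof (intro exI bexI allI)
  let ?m = "\<lambda>j. if j = i then (1, 0) else (0, 0 :: nat)"
  show "mono_fun I ?m \<in> mhom I (\<lambda>j. if j = i then 1 else 0)"
    using assms by (intro mhom_monomial) (auto simp: has_multideg_def)
  fix x
  have "mono_fun I ?m x = (\<Prod>j\<in>I. if j = i then fst (hc (x i)) else 1)"
    unfolding mono_fun_def by (rule prod.cong) auto
  also have "\<dots> = fst (hc (x i))" using assms by simp
  finally show "mono_fun I ?m x = 0 \<longleftrightarrow> x i = None"
    by (simp add: hc_def split: option.splits)
qed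

section \<open>Zariski closed sets, closures and irreducible sets through vanishing forms\<close>

lemma zariski_closed_zeros: "f \<in> mhom I e \<Longrightarrow> zariski_closed I {x \<in> pts I. f x = 0}"
proof -
  assume "f \<in> mhom I e"
  then obtain cf where "multihom I cf e" "f = peval I cf" by (auto simp: mhom_def)
  then show ?thesis
    unfolding zariski_closed_def by (intro exI[of _ "{(cf, e)}"]) auto
qed

lemma zariski_closed_separation:
  assumes "zariski_closed I S" "x \<in> pts I" "x \<notin> S"
  shows "\<exists>e. \<exists>f \<in> mhom I e. f x \<noteq> 0 \<and> (\<forall>y\<in>S. f y = 0)"
proof -
  obtain F where F: "\<forall>(cf, e)\<in>F. multihom I cf e"
    "S = {x \<in> pts I. \<forall>(cf, e)\<in>F. peval I cf x = 0}"
    using assms(1) unfolding zariski_closed_def by blast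
  with assms(2,3) obtain cf e where cf: "(cf, e) \<in> F" "peval I cf x \<noteq> 0" by auto
  show ?thesis
    by (rule exI[of _ e], rule bexI[of _ "peval I cf"]) (use F cf in \<open>auto simp: mhom_def\<close>)
qed

lemma zariski_closed_subset_pts: "zariski_closed I S \<Longrightarrow> S \<subseteq> pts I"
  by (auto simp: zariski_closed_def)

text \<open>Closed sets are intersections of zero sets of forms, so membership in the closure can be
  tested one form at a time. If \<open>A\<close> were not inside \<open>pts I\<close>, no closed set
  would contain it and the intersection would be everything.\<close>

lemma zariski_closure_eq:
  assumes "A \<subseteq> pts I"
  shows "zariski_closure I A = {x \<in> pts I. \<forall>e. \<forall>f \<in> mhom I e. (\<forall>a\<in>A. f a = 0) \<longrightarrow> f x = 0}"
    (is "_ = ?R")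
proof (intro equalityI subsetI)
  fix x assume x: "x \<in> zariski_closure I A"
  then have *: "x \<in> S" if "zariski_closed I S" "A \<subseteq> S" for S
    using that unfolding zariski_closure_def by blast
  have "zariski_closed I (pts I)"
    unfolding zariski_closed_def by (rule exI[of _ "{}"]) simp
  with * assms have "x \<in> pts I" by blast
  moreover have "f x = 0" if "f \<in> mhom I e" "\<forall>a\<in>A. f a = 0" for e f
  proof -
    have "A \<subseteq> {x \<in> pts I. f x = 0}" using that(2) assms by auto
    from *[OF zariski_closed_zeros[OF that(1)] this] show ?thesis by simp
  qed
  ultimately show "x \<in> ?R" by simp
next
  fix x assume x: "x \<in> ?R"
  show "x \<in> zariski_closure I A"
    unfolding zariski_closure_def
  proof (intro InterI, elim CollectE conjE)
    fix S assume S: "zariski_closed I S" "A \<subseteq> S"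
    show "x \<in> S"
    proof (rule ccontr)
      assume "x \<notin> S"
      have "x \<in> pts I" using x by simp
      from zariski_closed_separation[OF S(1) this \<open>x \<notin> S\<close>]
      obtain e f where f: "f \<in> mhom I e" "f x \<noteq> 0" "\<forall>y\<in>S. f y = 0" by auto
      then have "\<forall>a\<in>A. f a = 0" using S(2) by auto
      moreover have "(\<forall>a\<in>A. f a = 0) \<longrightarrow> f x = 0" using x f(1) by simp
      ultimately show False using f(2) by simp
    qed
  qed
qed

lemma zariski_closed_closure:
  assumes "A \<subseteq> pts I"
  shows "zariski_closed I (zariski_closure I A)"
proof -
  let ?F = "{(cf, e). multihom I cf e \<and> (\<forall>a\<in>A. peval I cf a = 0)}"
  have "zariski_closure I A = {x \<in> pts I. \<forall>(cf, e)\<in>?F. peval I cf x = 0}"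
    unfolding zariski_closure_eq[OF assms] by (fastforce simp: mhom_def)
  moreover have "\<forall>(cf, e)\<in>?F. multihom I cf e" by blast
  ultimately show ?thesis unfolding zariski_closed_def by blast
qed

lemma zariski_closure_superset: "A \<subseteq> zariski_closure I A"
  by (auto simp: zariski_closure_def)

lemma zariski_closure_minimal: "zariski_closed I S \<Longrightarrow> A \<subseteq> S \<Longrightarrow> zariski_closure I A \<subseteq> S"
  by (auto simp: zariski_closure_def)

text \<open>The two zero sets cover \<open>Z\<close>, so one of them contains it. Forms restricted
  to an irreducible set can thus be cancelled as in an integral domain.\<close>

lemma zariski_irreducible_mult:
  assumes "zariski_irreducible I Z" "Z \<subseteq> pts I" "f \<in> mhom I e" "g \<in> mhom I e'"
    and "\<And>x. x \<in> Z \<Longrightarrow> f x * g x = 0"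
  shows "(\<forall>x\<in>Z. f x = 0) \<or> (\<forall>x\<in>Z. g x = 0)"
proof -
  have "Z \<subseteq> {x \<in> pts I. f x = 0} \<union> {x \<in> pts I. g x = 0}" using assms(2,5) by auto
  with assms(1) zariski_closed_zeros[OF assms(3)] zariski_closed_zeros[OF assms(4)]
  have "Z \<subseteq> {x \<in> pts I. f x = 0} \<or> Z \<subseteq> {x \<in> pts I. g x = 0}"
    unfolding zariski_irreducible_def by blast
  then show ?thesis by auto
qed

section \<open>Flats of the root system\<close>

definition cpx :: "real^'n \<Rightarrow> complex^'n" where
  "cpx v = (\<chi> i. complex_of_real (v $ i))"

lemma ev_cpx [simp]: "ev lam (cpx v) = complex_of_real (lam \<bullet> v)"
  by (simp add: ev_def cpx_def inner_vec_def)

lemma ev_add_right: "ev lam (h + k) = ev lam h + ev lam k"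
  by (simp add: ev_def distrib_left sum.distrib)

lemma ev_scale_right: "ev lam (c *s h) = c * ev lam h"
  by (simp add: ev_def sum_distrib_left mult_ac)

lemma ev_zero_left [simp]: "ev 0 h = 0"
  by (simp add: ev_def)

lemma ev_add_left: "ev (a + b) h = ev a h + ev b h"
  by (simp add: ev_def distrib_right sum.distrib)

lemma ev_scale_left: "ev (c *\<^sub>R a) h = complex_of_real c * ev a h"
  by (simp add: ev_def sum_distrib_left mult_ac)

lemma ev_minus_left: "ev (- a) h = - ev a h"
  using ev_scale_left[of "-1" a h] by simp

text \<open>Roots are real, so the vanishing of a root at \<open>h\<close> amounts to two real
  orthogonality conditions, one on the real and one on the imaginary part.\<close>

lemma ev_eq_Complex: "ev lam h = Complex (lam \<bullet> (\<chi> i. Re (h $ i))) (lam \<bullet> (\<chi> i. Im (h $ i)))"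
  by (simp add: ev_def inner_vec_def complex_eq_iff)

lemma cpx_Re_Im: "h = cpx (\<chi> i. Re (h $ i)) + \<i> *s cpx (\<chi> i. Im (h $ i))"
  by (simp add: vec_eq_iff cpx_def complex_eq_iff)

lemma ev_eq_zero_span:
  assumes "h \<in> perp S" "lam \<in> span S"
  shows "ev lam h = 0"
proof -
  have "span S \<subseteq> {lam. ev lam h = 0}"
    by (rule span_minimal)
      (use assms(1) in \<open>auto simp: perp_def ev_add_left ev_scale_left subspace_def\<close>)
  with assms(2) show ?thesis by blast
qed

text \<open>Double annihilator property: the component \<open>z\<close> of \<open>lam\<close>
  orthogonal to \<open>span S\<close> gives the test point \<open>cpx z\<close>, at which
  \<open>lam\<close> takes the value \<open>z \<bullet> z\<close>.\<close>

lemma in_span_iff_ev: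
  fixes S :: "(real^'n::finite) set"
  shows "lam \<in> span S \<longleftrightarrow> (\<forall>h\<in>perp S. ev lam h = 0)"
proof
  assume *: "\<forall>h\<in>perp S. ev lam h = 0"
  obtain y z where yz: "y \<in> span S" "\<And>w. w \<in> span S \<Longrightarrow> orthogonal z w" "lam = y + z"
    using orthogonal_subspace_decomp_exists by blast
  have "cpx z \<in> perp S"
    using yz(2)[OF span_base] by (auto simp: perp_def orthogonal_def inner_commute)
  with * have "lam \<bullet> z = 0" by auto
  moreover have "y \<bullet> z = 0" using yz by (simp add: orthogonal_def inner_commute)
  ultimately have "z = 0" using yz(3) by (simp add: inner_left_distrib)
  with yz show "lam \<in> span S" by simp
qed (use ev_eq_zero_span in blast)

lemma perp_antimono: "S \<subseteq> T \<Longrightarrow> perp T \<subseteq> perp S"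
  by (auto simp: perp_def)

lemma perp_span: "perp (span S) = perp S"
  using ev_eq_zero_span[of _ S] span_superset[of S] by (auto simp: perp_def)

text \<open>\<open>perp S\<close> is the complexification of the real orthogonal complement
  \<open>U\<close> of \<open>S\<close>, so a real basis of \<open>U\<close> becomes a complex basis
  of \<open>perp S\<close>.\<close>

lemma vec_dim_perp:
  fixes S :: "(real^'n::finite) set"
  shows "vec.dim (perp S) = CARD('n) - dim (span S)"
proof -
  define U where "U = {y :: real^'n. \<forall>x\<in>span S. orthogonal x y}"
  have U_iff: "v \<in> U \<longleftrightarrow> (\<forall>s\<in>S. s \<bullet> v = 0)" for v
  proof
    assume *: "\<forall>s\<in>S. s \<bullet> v = 0"
    have "orthogonal v x" if "x \<in> span S" for x
      using that by (rule orthogonal_to_span) (use * in \<open>auto simp: orthogonal_def inner_commute\<close>)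
    then show "v \<in> U" by (auto simp: U_def orthogonal_commute)
  qed (auto simp: U_def orthogonal_def span_base)
  have sub: "subspace U" by (auto simp: subspace_def U_iff inner_right_distrib)
  have "dim U + dim (span S) = CARD('n)"
    using dim_subspace_orthogonal_to_vectors[of "span S" UNIV] by (simp add: U_def)
  then have dimU: "dim U = CARD('n) - dim (span S)" by simp
  obtain D where D: "D \<subseteq> U" "independent D" "U \<subseteq> span D" "card D = dim U"
    using basis_exists[of U] by blast
  have finD: "finite D" using D(2) by (rule independent_imp_finite)
  have inj: "inj_on cpx D" by (auto simp: inj_on_def cpx_def vec_eq_iff)
  have cpx_span: "cpx v \<in> vec.span (cpx ` D)" if "v \<in> span D" for v
    using that
  proof (induction rule: span_induct_alt)
    case base
    have "cpx 0 = (0 :: complex^'n)" by (simp add: cpx_def vec_eq_iff)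
    then show ?case by (simp add: vec.span_zero)
  next
    case (step c x y)
    have "cpx (c *\<^sub>R x + y) = complex_of_real c *s cpx x + cpx y"
      by (simp add: cpx_def vec_eq_iff)
    with step show ?case by (simp add: vec.span_add vec.span_scale vec.span_base)
  qed
  have "vec.dim (perp S) = card (cpx ` D)"
  proof (rule vec.dim_unique)
    show "cpx ` D \<subseteq> perp S" using D(1) by (auto simp: perp_def U_iff)
    show "perp S \<subseteq> vec.span (cpx ` D)"
    proof
      fix h assume h: "h \<in> perp S"
      let ?R = "\<chi> i. Re (h $ i)" and ?I = "\<chi> i. Im (h $ i)"
      have "?R \<in> U" "?I \<in> U"
        using h by (auto simp: U_iff perp_def ev_eq_Complex complex_eq_iff)
      then have "cpx ?R + \<i> *s cpx ?I \<in> vec.span (cpx ` D)"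
        using D(3) by (intro vec.span_add vec.span_scale cpx_span) auto
      then show "h \<in> vec.span (cpx ` D)" using cpx_Re_Im[of h] by simp
    qed
    \<comment> \<open>A complex relation between real vectors splits into two real relations, one
      for the real and one for the imaginary parts of its coefficients.\<close>
    show "vec.independent (cpx ` D)"
    proof
      assume "vec.dependent (cpx ` D)"
      then obtain u where u: "\<exists>v\<in>cpx ` D. u v \<noteq> 0" "(\<Sum>v\<in>cpx ` D. u v *s v) = 0"
        using vec.dependent_finite[of "cpx ` D"] finD by auto
      have "(\<Sum>d\<in>D. u (cpx d) *s cpx d) = 0" using u(2) inj by (simp add: sum.reindex)
      then have *: "(\<Sum>d\<in>D. u (cpx d) * complex_of_real (d $ i)) = 0" for i
        by (simp add: vec_eq_iff cpx_def)
      have "(\<Sum>d\<in>D. Re (u (cpx d)) *\<^sub>R d) = 0" "(\<Sum>d\<in>D. Im (u (cpx d)) *\<^sub>R d) = 0"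
        using arg_cong[OF *, of Re] arg_cong[OF *, of Im] by (simp_all add: vec_eq_iff)
      then have "\<forall>d\<in>D. Re (u (cpx d)) = 0 \<and> Im (u (cpx d)) = 0"
        using D(2) dependent_finite[OF finD] by auto
      with u(1) show False by (auto simp: complex_eq_iff)
    qed
  qed simp
  then show ?thesis using card_image[OF inj] D(4) dimU by simp
qed

lemma codim_perp:
  fixes S :: "(real^'n::finite) set"
  shows "codim (perp S) = rk S"
  \<comment> \<open>The two subtractions of naturals cancel only because the dimension is at most
    \<open>CARD('n)\<close>.\<close>
  using dim_subset_UNIV_cart[of "span S"] by (simp add: codim_def vec_dim_perp rk_def)

text \<open>A real subspace is not covered by finitely many proper hyperplanes: a vector good for
  \<open>A\<close> is moved slightly in a direction \<open>w\<close> good for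
  \<open>a\<close>.\<close>

lemma generic_vector:
  fixes U :: "(real^'n::finite) set"
  assumes "finite A" "subspace U" "\<And>a. a \<in> A \<Longrightarrow> \<exists>u\<in>U. a \<bullet> u \<noteq> 0"
  shows "\<exists>u\<in>U. \<forall>a\<in>A. a \<bullet> u \<noteq> 0"
  using assms(1,3)
proof (induction A)
  case empty
  then show ?case using subspace_0[OF assms(2)] by blast
next
  case (insert a A)
  then obtain u where u: "u \<in> U" "\<forall>a\<in>A. a \<bullet> u \<noteq> 0" by blast
  obtain w where w: "w \<in> U" "a \<bullet> w \<noteq> 0" using insert.prems by blast
  \<comment> \<open>For each \<open>b\<close> not orthogonal to \<open>w\<close>, this is the only
    multiple of \<open>w\<close> whose addition to \<open>u\<close> makes the sum orthogonal to
    \<open>b\<close>.\<close>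
  define X where "X = (\<lambda>b. - (b \<bullet> u) / (b \<bullet> w)) ` insert a A"
  have "finite X" using insert by (simp add: X_def)
  then obtain s where s: "s \<notin> X" "s \<noteq> 0"
    using ex_new_if_finite[OF infinite_UNIV_char_0, of "insert 0 X"] by auto
  have "b \<bullet> (u + s *\<^sub>R w) \<noteq> 0" if b: "b \<in> insert a A" for b
  proof (cases "b \<bullet> w = 0")
    case True
    then have "b \<in> A" using b w by auto
    with u True show ?thesis by (simp add: inner_right_distrib)
  next
    case False
    show ?thesis
    proof
      assume "b \<bullet> (u + s *\<^sub>R w) = 0"
      with False have "s = - (b \<bullet> u) / (b \<bullet> w)" by (simp add: inner_right_distrib field_simps)
      with s b show False by (auto simp: X_def)
    qed
  qed
  moreover have "u + s *\<^sub>R w \<in> U" using u w assms(2) by (simp add: subspace_add subspace_scale)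
  ultimately show ?case by blast
qed

section \<open>Flats and their identification with the step good subsystems\<close>

definition flat :: "(real^'n) set \<Rightarrow> (real^'n) set \<Rightarrow> bool" where
  "flat Phi Psi \<longleftrightarrow> Psi = Phi \<inter> span Psi"

lemma flat_subset: "flat Phi Psi \<Longrightarrow> Psi \<subseteq> Phi"
  by (auto simp: flat_def)

lemma span_Int_span:
  assumes "S \<subseteq> Phi"
  shows "span (Phi \<inter> span S) = span S"
proof
  show "span (Phi \<inter> span S) \<subseteq> span S" by (metis Int_lower2 span_mono span_span)
  show "span S \<subseteq> span (Phi \<inter> span S)"
    using assms span_superset[of S] by (intro span_mono) auto
qed

lemma flat_Int_span: "S \<subseteq> Phi \<Longrightarrow> flat Phi (Phi \<inter> span S)"
  by (simp add: flat_def span_Int_span)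

lemma flat_closed_subsystem:
  assumes "root_system Phi" "flat Phi Psi"
  shows "closed_subsystem Phi Psi"
  unfolding closed_subsystem_def
proof (intro conjI ballI impI)
  show "Psi \<subseteq> Phi" using assms(2) by (rule flat_subset)
  have in_Psi: "x \<in> Psi" if "x \<in> Phi" "x \<in> span Psi" for x
    using assms(2) that unfolding flat_def by blast
  fix a b assume ab: "a \<in> Psi" "b \<in> Psi"
  show "refl a b \<in> Psi"
  proof (rule in_Psi)
    show "refl a b \<in> Phi"
      using ab assms(1) flat_subset[OF assms(2)] unfolding root_system_def by blast
    show "refl a b \<in> span Psi"
      using ab unfolding refl_def by (intro span_diff span_scale span_base)
  qed
  show "a + b \<in> Psi" if "a + b \<in> Phi"
    using that span_add[OF span_base[OF ab(1)] span_base[OF ab(2)]] by (rule in_Psi)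
qed

text \<open>Nested spans of equal dimension coincide, and a flat already contains every root in its
  span.\<close>

lemma flat_eq_if_rk_le:
  fixes Psi Psi' :: "(real^'n::finite) set"
  assumes "flat Phi Psi" "Psi \<subseteq> Psi'" "Psi' \<subseteq> Phi" "rk Psi' \<le> rk Psi"
  shows "Psi' = Psi"
proof -
  have "span (span Psi) = span (span Psi')"
    using assms(4) span_mono[OF assms(2)] by (intro dim_eq_span) (simp_all add: rk_def)
  then have "span Psi = span Psi'" by (simp only: span_span)
  then have "Psi' \<subseteq> Phi \<inter> span Psi" using assms(3) span_superset[of Psi'] by auto
  also have "\<dots> = Psi" using assms(1) by (simp add: flat_def)
  finally show ?thesis using assms(2) by blast
qed

lemma rk_Int_span: "S \<subseteq> Phi \<Longrightarrow> rk (Phi \<inter> span S) = rk S"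
  by (simp add: rk_def span_Int_span)

text \<open>The flat generated by \<open>Psi\<close> is a closed subsystem of the same rank still
  inside \<open>Theta\<close>, so maximality forces it to be \<open>Psi\<close>.\<close>

lemma good_subsystem_flat:
  fixes Phi :: "(real^'n::finite) set"
  assumes "root_system Phi" "flat Phi Theta" "good_subsystem Phi Theta Psi"
  shows "flat Phi Psi"
proof -
  have Psi: "Psi \<subseteq> Theta" "rk Psi = rk Theta - 1" using assms(3) by (auto simp: good_subsystem_def)
  then have sub: "Psi \<subseteq> Phi" using flat_subset[OF assms(2)] by blast
  let ?F = "Phi \<inter> span Psi"
  have "?F \<subseteq> Phi \<inter> span Theta" using span_mono[OF Psi(1)] by blast
  also have "\<dots> = Theta" using assms(2) by (simp add: flat_def)
  finally have "?F \<subseteq> Theta" .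
  moreover have "Psi \<subseteq> ?F" using sub span_superset by auto
  moreover have "closed_subsystem Phi ?F"
    using assms(1) flat_Int_span[OF sub] by (rule flat_closed_subsystem)
  moreover have "rk ?F = rk Theta - 1" using Psi(2) sub by (simp add: rk_Int_span)
  ultimately have "?F = Psi" using assms(3) by (auto simp: good_subsystem_def)
  then show ?thesis by (simp add: flat_def)
qed

text \<open>Converse of \<open>good_subsystem_flat\<close>: a flat is maximal even among all sets of
  roots of its rank, by \<open>flat_eq_if_rk_le\<close>.\<close>

lemma flat_good_subsystem:
  fixes Phi :: "(real^'n::finite) set"
  assumes "root_system Phi" "flat Phi Theta" "flat Phi Psi" "Psi \<subseteq> Theta" "rk Theta = Suc (rk Psi)"
  shows "good_subsystem Phi Theta Psi"
  unfolding good_subsystem_def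
proof (intro conjI allI impI)
  fix Psi' assume "Psi \<subseteq> Psi' \<and> Psi' \<subseteq> Theta \<and> closed_subsystem Phi Psi' \<and> rk Psi' = rk Theta - 1"
  with assms show "Psi' = Psi"
    by (intro flat_eq_if_rk_le[of Phi]) (auto simp: closed_subsystem_def)
qed (use assms flat_closed_subsystem in auto)

lemma rk_insert:
  fixes S :: "(real^'n::finite) set"
  assumes "a \<notin> span S"
  shows "rk (insert a S) = Suc (rk S)"
  using assms by (simp add: rk_def dim_insert)

text \<open>The roots span the whole space, so some root lies outside \<open>span Psi\<close>;
  adjoining it raises the rank by exactly one.\<close>

lemma flat_cover:
  fixes Phi :: "(real^'n::finite) set"
  assumes "root_system Phi" "flat Phi Psi" "rk Psi < CARD('n)"
  shows "\<exists>Theta. flat Phi Theta \<and> Psi \<subseteq> Theta \<and> rk Theta = Suc (rk Psi)"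
proof -
  have "\<not> Phi \<subseteq> span Psi"
  proof
    assume "Phi \<subseteq> span Psi"
    then have "span Phi \<subseteq> span Psi" using span_mono span_span by metis
    then have "span Psi = UNIV" using assms(1) by (auto simp: root_system_def)
    with assms(3) show False by (simp add: rk_def)
  qed
  then obtain a where a: "a \<in> Phi" "a \<notin> span Psi" by blast
  have sub: "insert a Psi \<subseteq> Phi" using a flat_subset[OF assms(2)] by blast
  show ?thesis
  proof (intro exI conjI)
    show "flat Phi (Phi \<inter> span (insert a Psi))" using sub by (rule flat_Int_span)
    show "Psi \<subseteq> Phi \<inter> span (insert a Psi)" using sub by (auto intro: span_base)
    show "rk (Phi \<inter> span (insert a Psi)) = Suc (rk Psi)"
      using rk_Int_span[OF sub] rk_insert[OF a(2)] by simp
  qed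
qed

text \<open>Each good step lowers the rank of a flat by one, and every flat of positive corank has a
  cover from which it is reached. Writing the rank condition as a sum avoids truncated subtraction
  and excludes \<open>k\<close> larger than the rank.\<close>

lemma kstep_good_iff_flat:
  fixes Phi :: "(real^'n::finite) set"
  assumes "root_system Phi"
  shows "Psi \<in> kstep_good Phi k \<longleftrightarrow> flat Phi Psi \<and> rk Psi + k = CARD('n)"
proof (induction k arbitrary: Psi)
  case 0
  have *: "flat Phi Phi" "rk Phi = CARD('n)"
    using assms by (auto simp: flat_def root_system_def rk_def)
  show ?case
    using * flat_eq_if_rk_le[of Phi Psi Phi] flat_subset[of Phi Psi] by auto
next
  case (Suc k)
  show ?case
  proof
    assume "Psi \<in> kstep_good Phi (Suc k)"
    then obtain Theta where T: "Theta \<in> kstep_good Phi k" "good_subsystem Phi Theta Psi" by auto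
    then show "flat Phi Psi \<and> rk Psi + Suc k = CARD('n)"
      using Suc.IH[of Theta] good_subsystem_flat[OF assms _ T(2)] by (auto simp: good_subsystem_def)
  next
    assume Psi: "flat Phi Psi \<and> rk Psi + Suc k = CARD('n)"
    then obtain Theta where T: "flat Phi Theta" "Psi \<subseteq> Theta" "rk Theta = Suc (rk Psi)"
      using flat_cover[OF assms, of Psi] by auto
    with Psi have "Theta \<in> kstep_good Phi k" by (simp add: Suc.IH)
    with T Psi flat_good_subsystem[OF assms] show "Psi \<in> kstep_good Phi (Suc k)" by auto
  qed
qed

text \<open>Dropping one root from a basis of \<open>span Psi\<close> inside \<open>Psi\<close>
  gives a flat of rank one less. These flags give the lower bound on the dimension of a
  stratum.\<close>

lemma flat_chain:
  fixes Phi :: "(real^'n::finite) set"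
  assumes "flat Phi Psi"
  shows "\<exists>Q. Q (rk Psi) = Psi \<and> (\<forall>k\<le>rk Psi. flat Phi (Q k)) \<and> (\<forall>k<rk Psi. Q k \<subset> Q (Suc k))"
  using assms
proof (induction "rk Psi" arbitrary: Psi)
  case 0
  then show ?case by (intro exI[of _ "\<lambda>_. Psi"]) auto
next
  case (Suc m)
  obtain B where B: "B \<subseteq> Psi" "independent B" "Psi \<subseteq> span B" "card B = dim Psi"
    using basis_exists[of Psi] by blast
  have finB: "finite B" using B(2) by (rule independent_imp_finite)
  have cardB: "card B = Suc m" using B(4) Suc.hyps(2) by (simp add: rk_def)
  then obtain b where b: "b \<in> B" by fastforce
  define C where "C = B - {b}"
  have indC: "independent C" using B(2) unfolding C_def by (rule independent_mono) auto
  have rkC: "rk C = m"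
    using dim_eq_card_independent[OF indC] cardB b finB by (simp add: rk_def C_def)
  have CPhi: "C \<subseteq> Phi" using B(1) flat_subset[OF Suc.prems] by (auto simp: C_def)
  define Psi' where "Psi' = Phi \<inter> span C"
  have Psi': "flat Phi Psi'" "rk Psi' = m"
    using flat_Int_span[OF CPhi] rk_Int_span[OF CPhi] rkC by (auto simp: Psi'_def)
  have "span C \<subseteq> span Psi" using B(1) by (intro span_mono) (auto simp: C_def)
  then have "Psi' \<subseteq> Phi \<inter> span Psi" by (auto simp: Psi'_def)
  also have "\<dots> = Psi" using Suc.prems by (simp add: flat_def)
  finally have "Psi' \<subseteq> Psi" .
  moreover have "Psi' \<noteq> Psi" using Psi'(2) Suc.hyps(2) by auto
  ultimately have psub: "Psi' \<subset> Psi" by blast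
  obtain Q where Q: "Q m = Psi'" "\<forall>k\<le>m. flat Phi (Q k)" "\<forall>k<m. Q k \<subset> Q (Suc k)"
    using Suc.hyps(1)[of Psi'] Psi' by metis
  show ?case
    unfolding Suc.hyps(2)[symmetric]
    by (rule exI[of _ "Q(Suc m := Psi)"])
      (use Q psub Suc.prems in \<open>auto simp: le_Suc_eq less_Suc_eq\<close>)
qed

section \<open>Strata and their closures\<close>

text \<open>Parametrises the stratum of \<open>Psi\<close> by the whole Cartan subalgebra, in
  general not injectively; \<open>pt P UNIV\<close> is \<open>emb P\<close>.\<close>

definition pt :: "(real^'n) set \<Rightarrow> (real^'n) set \<Rightarrow> complex^'n \<Rightarrow> real^'n \<Rightarrow> complex option" where
  "pt P Psi h = (\<lambda>lam. if lam \<in> P \<inter> Psi then Some (ev lam h) else None)"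

lemma stratum_eq_range: "stratum P Psi = range (pt P Psi)"
proof
  show "stratum P Psi \<subseteq> range (pt P Psi)"
  proof
    fix x assume "x \<in> stratum P Psi"
    then obtain h where "x \<in> pts P" "\<forall>lam\<in>P - Psi. x lam = None"
      "\<forall>lam\<in>P \<inter> Psi. x lam = Some (ev lam h)"
      unfolding stratum_def by blast
    then have "x = pt P Psi h" by (auto simp: pt_def pts_def fun_eq_iff)
    then show "x \<in> range (pt P Psi)" by blast
  qed
qed (auto simp: stratum_def pt_def pts_def)

lemma stratum_subset_pts: "stratum P Psi \<subseteq> pts P"
  by (auto simp: stratum_def)

lemma hc_pt: "lam \<in> P \<Longrightarrow> hc (pt P Psi h lam) = (if lam \<in> Psi then (1, ev lam h) else (0, 1))"
  by (simp add: hc_def pt_def)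

lemma mhom_line_poly:
  assumes "f \<in> mhom P e"
  shows "\<exists>q. \<forall>t. f (pt P Psi (h + t *s k)) = poly q t"
  using assms
proof (induction rule: mhom_induct)
  case zero
  show ?case by (rule exI[of _ 0]) simp
next
  case (add f c m)
  then obtain q where q: "\<And>t. f (pt P Psi (h + t *s k)) = poly q t" by blast
  \<comment> \<open>A finite coordinate contributes a power of an affine function of
    \<open>t\<close>; the infinite one, \<open>(0, 1)\<close>, contributes
    \<open>0 ^ fst (m lam)\<close>, which is 1 for exponent 0.\<close>
  define r where "r = (\<Prod>lam\<in>P. if lam \<in> Psi then [:ev lam h, ev lam k:] ^ snd (m lam)
    else [:0 ^ fst (m lam):])"
  have "mono_fun P m (pt P Psi (h + t *s k)) = poly r t" for t
    unfolding mono_fun_def r_def poly_prod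
    by (rule prod.cong) (simp_all add: hc_pt ev_add_right ev_scale_right)
  with q show ?case by (intro exI[of _ "q + smult c r"]) simp
qed

text \<open>A line in the parameter space joins a point outside \<open>Z1\<close> to a point outside
  \<open>Z2\<close>. The forms separating them restrict to nonzero polynomials on it, so some point
  of the line avoids both sets.\<close>

lemma irreducible_closure_stratum:
  "zariski_irreducible P (zariski_closure P (stratum P Psi))" (is "zariski_irreducible P ?Z")
  unfolding zariski_irreducible_def
proof (intro conjI allI impI)
  show "?Z \<noteq> {}" using zariski_closure_superset[of "stratum P Psi" P] by (auto simp: stratum_eq_range)
  fix Z1 Z2 assume *: "zariski_closed P Z1 \<and> zariski_closed P Z2 \<and> ?Z \<subseteq> Z1 \<union> Z2"
  have "stratum P Psi \<subseteq> Z1 \<or> stratum P Psi \<subseteq> Z2"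
  proof (rule ccontr)
    assume "\<not> ?thesis"
    then obtain h1 h2 where h: "pt P Psi h1 \<notin> Z1" "pt P Psi h2 \<notin> Z2"
      by (auto simp: stratum_eq_range)
    have pts: "pt P Psi h \<in> pts P" for h by (simp add: pt_def pts_def)
    obtain e1 f1 where f1: "f1 \<in> mhom P e1" "f1 (pt P Psi h1) \<noteq> 0" "\<forall>y\<in>Z1. f1 y = 0"
      using zariski_closed_separation[OF _ pts h(1)] * by auto
    obtain e2 f2 where f2: "f2 \<in> mhom P e2" "f2 (pt P Psi h2) \<noteq> 0" "\<forall>y\<in>Z2. f2 y = 0"
      using zariski_closed_separation[OF _ pts h(2)] * by auto
    let ?p = "\<lambda>t. pt P Psi (h1 + t *s (h2 - h1))"
    obtain q1 where q1: "\<And>t. f1 (?p t) = poly q1 t" using mhom_line_poly[OF f1(1)] by blast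
    obtain q2 where q2: "\<And>t. f2 (?p t) = poly q2 t" using mhom_line_poly[OF f2(1)] by blast
    have "poly q1 0 \<noteq> 0" "poly q2 1 \<noteq> 0"
      using f1(2) f2(2) by (simp_all add: q1[symmetric] q2[symmetric])
    then have "q1 * q2 \<noteq> 0" by auto
    then have "finite {t. poly (q1 * q2) t = 0}" by (rule poly_roots_finite)
    then obtain t where t: "poly (q1 * q2) t \<noteq> 0"
      using ex_new_if_finite[OF infinite_UNIV_char_0, of "{t. poly (q1 * q2) t = 0}"] by auto
    have "?p t \<in> Z1 \<union> Z2"
      using * zariski_closure_superset[of "stratum P Psi" P] by (auto simp: stratum_eq_range)
    then have "poly (q1 * q2) t = 0" using f1(3) f2(3) q1[of t] q2[of t] by auto
    with t show False by simp
  qed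
  then show "?Z \<subseteq> Z1 \<or> ?Z \<subseteq> Z2" using * zariski_closure_minimal by blast
qed

text \<open>With \<open>u = 1/s\<close>, the points \<open>pt P Psi' (h + s *s t)\<close> tend to \<open>pt P Psi h\<close> as \<open>s\<close>
  grows: in the coordinates \<open>lam\<close> from \<open>Psi' - Psi\<close> one clears denominators,
  \<open>[1 : lam(h) + lam(t)/u] = [u : u lam(h) + lam(t)]\<close>, and sets \<open>u = 0\<close>.\<close>

lemma mhom_degeneration_poly:
  assumes "f \<in> mhom P e" and sub: "Psi \<subseteq> Psi'" and t: "t \<in> perp Psi"
  shows "\<exists>q. (\<forall>u. u \<noteq> 0 \<longrightarrow> poly q u
        = (\<Prod>lam\<in>P. if lam \<in> Psi' - Psi then u ^ e lam else 1) * f (pt P Psi' (h + (1 / u) *s t)))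
      \<and> poly q 0 = (\<Prod>lam\<in>P. if lam \<in> Psi' - Psi then ev lam t ^ e lam else 1) * f (pt P Psi h)"
    (is "\<exists>q. (\<forall>u. u \<noteq> 0 \<longrightarrow> poly q u = ?C u * _) \<and> poly q 0 = ?L * _")
  using assms(1)
proof (induction rule: mhom_induct)
  case zero
  show ?case by (rule exI[of _ 0]) simp
next
  case (add f c m)
  then obtain q where q: "\<And>u. u \<noteq> 0 \<Longrightarrow> poly q u = ?C u * f (pt P Psi' (h + (1 / u) *s t))"
    "poly q 0 = ?L * f (pt P Psi h)" by blast
  \<comment> \<open>The factors are the coordinates with denominators cleared:
    \<open>[1 : lam(h)]\<close> on \<open>Psi\<close>, where \<open>lam(t) = 0\<close>, then
    \<open>[u : u lam(h) + lam(t)]\<close> on \<open>Psi' - Psi\<close>, and \<open>[0 : 1]\<close>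
    outside \<open>Psi'\<close>.\<close>
  define r where "r = (\<Prod>lam\<in>P. if lam \<in> Psi then [:ev lam h:] ^ snd (m lam)
    else if lam \<in> Psi' then [:0, 1:] ^ fst (m lam) * [:ev lam t, ev lam h:] ^ snd (m lam)
    else [:0 ^ fst (m lam):])"
  have deg: "e lam = fst (m lam) + snd (m lam)" if "lam \<in> P" for lam
    using add(2) that by (simp add: has_multideg_def)
  have t0: "ev lam t = 0" if "lam \<in> Psi" for lam using t that by (simp add: perp_def)
  have "poly r u = ?C u * mono_fun P m (pt P Psi' (h + (1 / u) *s t))" if "u \<noteq> 0" for u
    unfolding mono_fun_def r_def poly_prod prod.distrib[symmetric]
  proof (rule prod.cong)
    fix lam assume lam: "lam \<in> P"
    have *: "u * (ev lam h + ev lam t / u) = ev lam t + u * ev lam h"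
      using that by (simp add: field_simps)
    have "u ^ e lam * (ev lam h + ev lam t / u) ^ snd (m lam)
        = u ^ fst (m lam) * (ev lam t + u * ev lam h) ^ snd (m lam)"
      unfolding deg[OF lam] power_add *[symmetric] power_mult_distrib by (simp add: mult_ac)
    then show "poly (if lam \<in> Psi then [:ev lam h:] ^ snd (m lam)
        else if lam \<in> Psi' then [:0, 1:] ^ fst (m lam) * [:ev lam t, ev lam h:] ^ snd (m lam)
        else [:0 ^ fst (m lam):]) u
      = (if lam \<in> Psi' - Psi then u ^ e lam else 1)
        * (fst (hc (pt P Psi' (h + (1 / u) *s t) lam)) ^ fst (m lam)
          * snd (hc (pt P Psi' (h + (1 / u) *s t) lam)) ^ snd (m lam))"
      using lam t0 sub by (auto simp: hc_pt ev_add_right ev_scale_right)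
  qed simp
  moreover have "poly r 0 = ?L * mono_fun P m (pt P Psi h)"
    unfolding mono_fun_def r_def poly_prod prod.distrib[symmetric]
  proof (rule prod.cong)
    fix lam assume lam: "lam \<in> P"
    \<comment> \<open>If the first exponent is positive both sides vanish; if it is 0, the second
      exponent is all of \<open>e lam\<close>.\<close>
    have "0 ^ fst (m lam) * ev lam t ^ snd (m lam) = ev lam t ^ e lam * 0 ^ fst (m lam)"
      by (cases "fst (m lam)") (simp_all add: deg[OF lam])
    then show "poly (if lam \<in> Psi then [:ev lam h:] ^ snd (m lam)
        else if lam \<in> Psi' then [:0, 1:] ^ fst (m lam) * [:ev lam t, ev lam h:] ^ snd (m lam)
        else [:0 ^ fst (m lam):]) 0
      = (if lam \<in> Psi' - Psi then ev lam t ^ e lam else 1)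
        * (fst (hc (pt P Psi h lam)) ^ fst (m lam) * snd (hc (pt P Psi h lam)) ^ snd (m lam))"
      using lam sub by (auto simp: hc_pt)
  qed simp
  ultimately show ?case using q
    by (intro exI[of _ "q + smult c r"]) (simp add: algebra_simps)
qed

text \<open>As \<open>Psi\<close> is a flat, no root outside it vanishes on all of
  \<open>perp Psi\<close>; a generic real point of \<open>perp Psi\<close> then avoids all their
  hyperplanes at once.\<close>

lemma perp_generic:
  fixes Phi :: "(real^'n::finite) set"
  assumes "finite Phi" "flat Phi Psi"
  shows "\<exists>t\<in>perp Psi. \<forall>lam\<in>Phi - Psi. ev lam t \<noteq> 0"
proof -
  let ?U = "{v. \<forall>s\<in>Psi. s \<bullet> v = 0}"
  have "\<exists>u\<in>?U. a \<bullet> u \<noteq> 0" if a: "a \<in> Phi - Psi" for a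
  proof -
    have "a \<notin> span Psi" using a assms(2) unfolding flat_def by blast
    then obtain h where h: "h \<in> perp Psi" "ev a h \<noteq> 0" by (auto simp: in_span_iff_ev)
    let ?R = "\<chi> i. Re (h $ i)" and ?I = "\<chi> i. Im (h $ i)"
    have "?R \<in> ?U" "?I \<in> ?U" using h(1) by (auto simp: perp_def ev_eq_Complex complex_eq_iff)
    moreover have "a \<bullet> ?R \<noteq> 0 \<or> a \<bullet> ?I \<noteq> 0"
      using h(2) by (auto simp: ev_eq_Complex complex_eq_iff)
    ultimately show ?thesis by blast
  qed
  moreover have "subspace ?U" by (auto simp: subspace_def inner_right_distrib)
  ultimately obtain u where u: "u \<in> ?U" "\<forall>a\<in>Phi - Psi. a \<bullet> u \<noteq> 0"
    using generic_vector[of "Phi - Psi" ?U] assms(1) by auto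
  then show ?thesis by (intro bexI[of _ "cpx u"]) (auto simp: perp_def)
qed

text \<open>A form vanishing on the larger stratum makes the degeneration polynomial zero at every
  \<open>u \<noteq> 0\<close>, hence also at \<open>u = 0\<close>. There it is the value at the
  limit point times a factor that is nonzero because \<open>t\<close> is generic.\<close>

lemma stratum_subset_closure:
  fixes Phi P :: "(real^'n::finite) set"
  assumes "finite Phi" "P \<subseteq> Phi" "flat Phi Psi" "Psi \<subseteq> Psi'"
  shows "stratum P Psi \<subseteq> zariski_closure P (stratum P Psi')"
proof
  fix x assume x: "x \<in> stratum P Psi"
  then obtain h where h: "x = pt P Psi h" by (auto simp: stratum_eq_range)
  obtain t where t: "t \<in> perp Psi" "\<forall>lam\<in>Phi - Psi. ev lam t \<noteq> 0"
    using perp_generic[OF assms(1,3)] by blast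
  have "f x = 0" if f: "f \<in> mhom P e" "\<forall>a\<in>stratum P Psi'. f a = 0" for e f
  proof -
    obtain q where q: "\<And>u. u \<noteq> 0 \<Longrightarrow> poly q u
        = (\<Prod>lam\<in>P. if lam \<in> Psi' - Psi then u ^ e lam else 1) * f (pt P Psi' (h + (1 / u) *s t))"
      "poly q 0 = (\<Prod>lam\<in>P. if lam \<in> Psi' - Psi then ev lam t ^ e lam else 1) * f (pt P Psi h)"
      using mhom_degeneration_poly[OF f(1) assms(4) t(1)] by blast
    have "poly q u = 0" if "u \<noteq> 0" for u
      using q(1)[OF that] f(2) by (simp add: stratum_eq_range)
    then have "UNIV - {0} \<subseteq> {u. poly q u = 0}" by auto
    moreover have "infinite (UNIV - {0 :: complex})"
      by (simp add: infinite_UNIV_char_0)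
    ultimately have "q = 0" using poly_roots_finite[of q] finite_subset by blast
    moreover have "(\<Prod>lam\<in>P. if lam \<in> Psi' - Psi then ev lam t ^ e lam else 1) \<noteq> 0"
      using t(2) assms(2) finite_subset[OF assms(2,1)] by auto
    ultimately show ?thesis using q(2) by (simp add: h)
  qed
  then show "x \<in> zariski_closure P (stratum P Psi')"
    using x stratum_subset_pts unfolding zariski_closure_eq[OF stratum_subset_pts] by blast
qed

text \<open>For \<open>lam\<close> outside \<open>Psi'\<close> the coordinate at \<open>lam\<close>
  is infinite on the whole closure, whereas \<open>pt P Psi 0\<close> is finite at every root of
  \<open>P \<inter> Psi\<close>. Only roots of \<open>P\<close> have coordinates, hence the
  intersection.\<close>

lemma stratum_subset_closure_imp:
  assumes "finite P" "stratum P Psi \<subseteq> zariski_closure P (stratum P Psi')"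
  shows "P \<inter> Psi \<subseteq> Psi'"
proof
  fix lam assume lam: "lam \<in> P \<inter> Psi"
  obtain e f where f: "f \<in> mhom P e" "\<And>x. f x = 0 \<longleftrightarrow> x lam = None"
    using infinity_mhom[OF assms(1), of lam] lam by blast
  have x: "pt P Psi 0 \<in> zariski_closure P (stratum P Psi')"
    using assms(2) by (auto simp: stratum_eq_range)
  show "lam \<in> Psi'"
  proof (rule ccontr)
    assume "lam \<notin> Psi'"
    then have "\<forall>a\<in>stratum P Psi'. f a = 0" by (auto simp: f(2) stratum_eq_range pt_def)
    then have "f (pt P Psi 0) = 0"
      using x f(1) unfolding zariski_closure_eq[OF stratum_subset_pts] by simp
    then show False using lam by (simp add: f(2) pt_def)
  qed
qed

section \<open>Dimension\<close>

definition lin_indep_on :: "'x set \<Rightarrow> 'j set \<Rightarrow> ('j \<Rightarrow> 'x \<Rightarrow> complex) \<Rightarrow> bool" where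
  "lin_indep_on Z J h \<longleftrightarrow>
     (\<forall>c. (\<forall>x\<in>Z. (\<Sum>j\<in>J. c j * h j x) = 0) \<longrightarrow> (\<forall>j\<in>J. c j = 0))"

lemma lin_indep_on_card_le:
  fixes h :: "'j \<Rightarrow> 'x \<Rightarrow> complex" and b :: "'k \<Rightarrow> 'x \<Rightarrow> complex"
  assumes "finite J" "finite B" and indep: "lin_indep_on UNIV J h"
    and comb: "\<And>j. j \<in> J \<Longrightarrow> \<exists>a. \<forall>x. h j x = (\<Sum>k\<in>B. a k * b k x)"
  shows "card J \<le> card B"
proof -
  \<comment> \<open>Functions form a complex vector space under pointwise operations, so the usual
    bound by the size of a spanning set applies.\<close>
  interpret V: vector_space "\<lambda>(c::complex) (f :: 'x \<Rightarrow> complex) x. c * f x"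
    by unfold_locales (auto simp: fun_eq_iff algebra_simps)
  have sum_fun: "sum F A x = (\<Sum>a\<in>A. F a x)" for F :: "'z \<Rightarrow> 'x \<Rightarrow> complex" and A x
    by (induction A rule: infinite_finite_induct) auto
  have inj: "inj_on h J"
  proof (rule inj_onI, rule ccontr)
    fix i j assume ij: "i \<in> J" "j \<in> J" "h i = h j" "i \<noteq> j"
    let ?c = "\<lambda>k. if k = i then 1 else if k = j then - 1 else (0::complex)"
    have "(\<Sum>k\<in>J. ?c k * h k x) = 0" for x
    proof -
      have "(\<Sum>k\<in>J. ?c k * h k x)
          = (\<Sum>k\<in>J. (if k = i then h i x else 0) - (if k = j then h j x else 0))"
        by (rule sum.cong) (use ij in auto)
      also have "\<dots> = 0" using ij assms(1) by (simp add: sum_subtractf)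
      finally show ?thesis .
    qed
    then have "?c i = 0"
      using indep[unfolded lin_indep_on_def, rule_format, of ?c i] ij(1) by blast
    then show False by simp
  qed
  have "V.independent (h ` J)"
  proof
    assume "V.dependent (h ` J)"
    then obtain u where u: "\<exists>v\<in>h ` J. u v \<noteq> 0" "(\<Sum>v\<in>h ` J. (\<lambda>x. u v * v x)) = 0"
      using V.dependent_finite[of "h ` J"] assms(1) by auto
    have "(\<Sum>j\<in>J. u (h j) * h j x) = 0" for x
      using fun_cong[OF u(2), of x] inj by (simp add: sum_fun sum.reindex)
    then have "\<forall>j\<in>J. u (h j) = 0"
      using indep[unfolded lin_indep_on_def, rule_format, of "\<lambda>j. u (h j)"] by blast
    with u(1) show False by auto
  qed
  moreover have "h ` J \<subseteq> V.span (b ` B)"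
  proof safe
    fix j assume "j \<in> J"
    then obtain a where a: "\<And>x. h j x = (\<Sum>k\<in>B. a k * b k x)" using comb by blast
    have "h j = (\<Sum>k\<in>B. (\<lambda>x. a k * b k x))" by (simp add: fun_eq_iff sum_fun a)
    also have "\<dots> \<in> V.span (b ` B)"
      by (intro V.span_sum V.span_scale V.span_base) auto
    finally show "h j \<in> V.span (b ` B)" .
  qed
  ultimately have "card (h ` J) \<le> card (b ` B)"
    using V.independent_span_bound[of "b ` B" "h ` J"] assms(2) by simp
  then show ?thesis
    using card_image[OF inj] card_image_le[OF assms(2), of b] by linarith
qed

text \<open>A relation is a polynomial in \<open>f\<close> and \<open>g\<close>, homogeneous of
  degree \<open>K\<close>, with coefficients \<open>p a\<close>. Once those below \<open>a\<close>
  vanish, \<open>f ^ a\<close> cancels on \<open>Z\<close>; on \<open>Z'\<close>, where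
  \<open>f\<close> is zero, only \<open>p a\<close> times a power of \<open>g\<close> survives, and
  \<open>g\<close> cancels there too.\<close>

lemma lin_indep_on_extend:
  assumes Z: "zariski_irreducible I Z" "Z \<subseteq> pts I"
    and Z': "zariski_irreducible I Z'" "Z' \<subseteq> Z"
    and f: "f \<in> mhom I e" "\<forall>z\<in>Z'. f z = 0" "\<exists>z\<in>Z. f z \<noteq> 0"
    and g: "g \<in> mhom I e" "\<exists>z\<in>Z'. g z \<noteq> 0"
    and h: "\<And>j. j \<in> J \<Longrightarrow> h j \<in> mhom I E" and indep: "lin_indep_on Z' J h"
  shows "lin_indep_on Z (J \<times> {..K}) (\<lambda>(j, a) x. h j x * (f x ^ a * g x ^ (K - a)))"
  unfolding lin_indep_on_def
proof (intro allI impI)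
  fix c :: "'b \<times> nat \<Rightarrow> complex"
  assume zero: "\<forall>x\<in>Z. (\<Sum>i\<in>J \<times> {..K}. c i * (case i of (j, a) \<Rightarrow> \<lambda>x. h j x * (f x ^ a * g x ^ (K - a))) x) = 0"
  define p where "p a x = (\<Sum>j\<in>J. c (j, a) * h j x)" for a x
  have p: "p a \<in> mhom I E" for a
    unfolding p_def by (intro mhom_sum mhom_scale h)
  have zero': "(\<Sum>a\<le>K. p a x * (f x ^ a * g x ^ (K - a))) = 0" if "x \<in> Z" for x
  proof -
    have "(\<Sum>a\<le>K. p a x * (f x ^ a * g x ^ (K - a)))
        = (\<Sum>a\<le>K. \<Sum>j\<in>J. c (j, a) * (h j x * (f x ^ a * g x ^ (K - a))))"
      by (simp add: p_def sum_distrib_right mult.assoc)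
    also have "\<dots> = (\<Sum>i\<in>J \<times> {..K}. c i * (case i of (j, a) \<Rightarrow> \<lambda>x. h j x * (f x ^ a * g x ^ (K - a))) x)"
      by (subst sum.swap) (simp add: sum.cartesian_product case_prod_unfold)
    finally show ?thesis using zero that by simp
  qed
  have "\<forall>j\<in>J. c (j, a) = 0" if "a \<le> K" for a
    using that
  proof (induction a rule: less_induct)
    case (less a)
    \<comment> \<open>The relation divided by \<open>f ^ a\<close>; the powers of \<open>g\<close>
      give all its terms the same multidegree.\<close>
    define R where "R x = (\<Sum>b\<in>{a..K}. p b x * (f x ^ (b - a) * g x ^ (K - b)))" for x
    have R: "R \<in> mhom I (\<lambda>i. E i + (K - a) * e i)"
      unfolding R_def
    proof (rule mhom_sum)
      fix b assume b: "b \<in> {a..K}"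
      have "(\<lambda>x. p b x * (f x ^ (b - a) * g x ^ (K - b)))
          \<in> mhom I (\<lambda>i. E i + ((b - a) * e i + (K - b) * e i))"
        by (intro mhom_mult mhom_power f(1) g(1) p)
      also have "(\<lambda>i. E i + ((b - a) * e i + (K - b) * e i)) = (\<lambda>i. E i + (K - a) * e i)"
        using b by (simp add: add_mult_distrib[symmetric])
      finally show "(\<lambda>x. p b x * (f x ^ (b - a) * g x ^ (K - b))) \<in> mhom I (\<lambda>i. E i + (K - a) * e i)" .
    qed
    have "f x ^ a * R x = 0" if "x \<in> Z" for x
    proof -
      have "f x ^ a * R x = (\<Sum>b\<in>{a..K}. p b x * (f x ^ b * g x ^ (K - b)))"
        unfolding R_def sum_distrib_left
      proof (rule sum.cong)
        fix b assume "b \<in> {a..K}"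
        then have "f x ^ b = f x ^ a * f x ^ (b - a)" by (simp add: power_add[symmetric])
        then show "f x ^ a * (p b x * (f x ^ (b - a) * g x ^ (K - b)))
            = p b x * (f x ^ b * g x ^ (K - b))" by (simp add: mult_ac)
      qed simp
      also have "\<dots> = (\<Sum>b\<le>K. p b x * (f x ^ b * g x ^ (K - b)))"
        by (rule sum.mono_neutral_left) (use less in \<open>auto simp: p_def\<close>)
      finally show ?thesis using zero'[OF that] by simp
    qed
    from zariski_irreducible_mult[OF Z mhom_power[OF f(1)] R this]
    have R0: "\<forall>x\<in>Z. R x = 0" using f(3) by auto
    have "p a x * g x ^ (K - a) = 0" if "x \<in> Z'" for x
    proof -
      \<comment> \<open>On \<open>Z'\<close> only the term \<open>b = a\<close> remains, by
        \<open>0 ^ 0 = 1\<close>.\<close>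
      have "R x = (\<Sum>b\<in>{a..K}. if b = a then p a x * g x ^ (K - a) else 0)"
        unfolding R_def by (rule sum.cong) (use f(2) that in \<open>auto simp: power_0_left\<close>)
      also have "\<dots> = p a x * g x ^ (K - a)" using less.prems by simp
      finally show ?thesis using R0 Z'(2) that by auto
    qed
    from zariski_irreducible_mult[OF Z'(1) _ p mhom_power[OF g(1)] this]
    have "\<forall>x\<in>Z'. p a x = 0" using Z'(2) Z(2) g(2) by auto
    then show "\<forall>j\<in>J. c (j, a) = 0"
      using indep[unfolded lin_indep_on_def, rule_format, of "\<lambda>j. c (j, a)"] by (simp add: p_def)
  qed
  then show "\<forall>i\<in>J \<times> {..K}. c i = 0" by auto
qed

text \<open>Pairs are encoded as naturals through this lemma, so that the index type stays fixed in
  the induction along a chain.\<close>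

lemma lin_indep_on_reindex:
  assumes "inj_on r J" "\<And>j. j \<in> J \<Longrightarrow> h' (r j) = h j" "lin_indep_on Z J h"
  shows "lin_indep_on Z (r ` J) h'"
  unfolding lin_indep_on_def
proof (intro allI impI)
  fix c :: "_ \<Rightarrow> complex"
  assume "\<forall>x\<in>Z. (\<Sum>j\<in>r ` J. c j * h' j x) = 0"
  then have "\<forall>x\<in>Z. (\<Sum>j\<in>J. c (r j) * h j x) = 0"
    using assms(1,2) by (simp add: sum.reindex)
  then show "\<forall>j\<in>r ` J. c j = 0"
    using assms(3)[unfolded lin_indep_on_def, rule_format, of "\<lambda>j. c (r j)"] by blast
qed

text \<open>Each inclusion multiplies the size of the family by \<open>K + 1\<close>. The constant
  \<open>T\<close> is chosen before \<open>K\<close>, so multidegrees grow only linearly in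
  \<open>K\<close>.\<close>

lemma chain_lin_indep:
  assumes "finite I"
    and "\<forall>k\<le>n. zariski_closed I (Z k) \<and> zariski_irreducible I (Z k)"
    and "\<forall>k<n. Z k \<subset> Z (Suc k)"
  shows "\<exists>T. \<forall>K. \<exists>(J :: nat set) h E. finite J \<and> card J = (K + 1) ^ n \<and> (\<forall>i\<in>I. E i \<le> K * T)
    \<and> (\<forall>j\<in>J. h j \<in> mhom I E) \<and> lin_indep_on (Z n) J h"
  using assms(2,3)
proof (induction n)
  case 0
  then obtain z where z: "z \<in> Z 0" by (auto simp: zariski_irreducible_def)
  have "lin_indep_on (Z 0) {0 :: nat} (\<lambda>_ _. 1)" using z by (auto simp: lin_indep_on_def)
  then show ?case
    by (intro exI[of _ 0] allI exI[of _ "{0}"] exI[of _ "\<lambda>_ _. 1"] exI[of _ "\<lambda>_. 0"])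
      (auto simp: mhom_one)
next
  case (Suc n)
  obtain T where T: "\<And>K. \<exists>(J :: nat set) h E. finite J \<and> card J = (K + 1) ^ n \<and> (\<forall>i\<in>I. E i \<le> K * T)
    \<and> (\<forall>j\<in>J. h j \<in> mhom I E) \<and> lin_indep_on (Z n) J h"
    using Suc.IH Suc.prems by auto
  have Z: "zariski_irreducible I (Z (Suc n))" "Z (Suc n) \<subseteq> pts I"
    and Z': "zariski_irreducible I (Z n)" "zariski_closed I (Z n)" "Z n \<subseteq> Z (Suc n)"
    using Suc.prems zariski_closed_subset_pts[of I "Z (Suc n)"] by auto
  obtain w where w: "w \<in> Z (Suc n)" "w \<notin> Z n" using Suc.prems(2) by blast
  obtain e f where f: "f \<in> mhom I e" "f w \<noteq> 0" "\<forall>y\<in>Z n. f y = 0"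
    using zariski_closed_separation[OF Z'(2) _ w(2)] w(1) Z(2) by auto
  obtain z where z: "z \<in> Z n" using Z'(1) by (auto simp: zariski_irreducible_def)
  obtain g where g: "g \<in> mhom I e" "g z \<noteq> 0" using pts_separation[of z I e] z Z'(3) Z(2) by auto
  show ?case
  \<comment> \<open>The new factors add \<open>K * e i\<close> to the degree at \<open>i\<close>,
    and the sum of all \<open>e i\<close> bounds each of them uniformly.\<close>
  proof (intro exI[of _ "T + (\<Sum>i\<in>I. e i)"] allI)
    fix K
    obtain J :: "nat set" and h E where J: "finite J" "card J = (K + 1) ^ n" "\<forall>i\<in>I. E i \<le> K * T"
      "\<forall>j\<in>J. h j \<in> mhom I E" "lin_indep_on (Z n) J h" using T[of K] by auto
    define h1 where "h1 = (\<lambda>(j, a) x. h j x * (f x ^ a * g x ^ (K - a)))"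
    define h2 where "h2 i = h1 (prod_decode i)" for i
    let ?J = "prod_encode ` (J \<times> {..K})"
    have indep: "lin_indep_on (Z (Suc n)) (J \<times> {..K}) h1"
      unfolding h1_def using Z Z' f g w(1) z J by (intro lin_indep_on_extend[of I _ "Z n"]) auto
    have "lin_indep_on (Z (Suc n)) ?J h2"
      by (rule lin_indep_on_reindex[OF inj_on_subset[OF inj_prod_encode] _ indep])
        (auto simp: h2_def)
    moreover have "card ?J = (K + 1) ^ Suc n"
      using J(2) card_image[OF inj_on_subset[OF inj_prod_encode subset_UNIV], of "J \<times> {..K}"]
      by (simp add: card_cartesian_product)
    moreover have "h2 i \<in> mhom I (\<lambda>i. E i + K * e i)" if "i \<in> ?J" for i
    proof -
      obtain j a where ja: "i = prod_encode (j, a)" "j \<in> J" "a \<le> K" using \<open>i \<in> ?J\<close> by auto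
      have "(\<lambda>x. h j x * (f x ^ a * g x ^ (K - a))) \<in> mhom I (\<lambda>i. E i + (a * e i + (K - a) * e i))"
        using ja J(4) by (intro mhom_mult mhom_power f(1) g(1)) auto
      also have "(\<lambda>i. E i + (a * e i + (K - a) * e i)) = (\<lambda>i. E i + K * e i)"
        using ja by (simp add: add_mult_distrib[symmetric])
      finally show ?thesis by (simp add: h2_def h1_def ja)
    qed
    moreover have "E i + K * e i \<le> K * (T + (\<Sum>i\<in>I. e i))" if "i \<in> I" for i
      using J(3) that member_le_sum[OF that, of e] assms(1)
      by (auto simp: distrib_left intro!: add_mono mult_le_mono2)
    moreover have "finite ?J" using J(1) by simp
    ultimately show "\<exists>(J :: nat set) h E. finite J \<and> card J = (K + 1) ^ Suc n
      \<and> (\<forall>i\<in>I. E i \<le> K * (T + (\<Sum>i\<in>I. e i))) \<and> (\<forall>j\<in>J. h j \<in> mhom I E) \<and> lin_indep_on (Z (Suc n)) J h"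
      by (intro exI[of _ ?J] exI[of _ h2] exI[of _ "\<lambda>i. E i + K * e i"]) simp
  qed
qed

text \<open>Polynomials in the coordinates \<open>ev b\<close>, \<open>b \<in> B\<close>, of degree at most \<open>N\<close> in each, are obtained by
dehomogenizing: on \<open>pt B UNIV h\<close> all homogeneous coordinates are \<open>(1, ev b h)\<close>.\<close>

definition aff_poly :: "(real^'n) set \<Rightarrow> nat \<Rightarrow> (complex^'n \<Rightarrow> complex) set" where
  "aff_poly B N = {F. \<exists>g\<in>mhom B (\<lambda>_. N). \<forall>h. F h = g (pt B UNIV h)}"

lemma aff_poly_const: "(\<lambda>h. c) \<in> aff_poly B N"
proof -
  let ?m = "\<lambda>i. if i \<in> B then (N, 0) else (0, 0 :: nat)"
  have "mono_fun B ?m \<in> mhom B (\<lambda>_. N)" by (rule mhom_monomial) (simp add: has_multideg_def)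
  from mhom_scale[OF this, of c]
  have "(\<lambda>x. c * mono_fun B ?m x) \<in> mhom B (\<lambda>_. N)" .
  moreover have "mono_fun B ?m (pt B UNIV h) = 1" for h by (simp add: mono_fun_def hc_pt)
  ultimately show ?thesis unfolding aff_poly_def by (intro CollectI bexI) auto
qed

lemma aff_poly_add:
  assumes "F \<in> aff_poly B N" "G \<in> aff_poly B N"
  shows "(\<lambda>h. F h + G h) \<in> aff_poly B N"
proof -
  obtain f g where "f \<in> mhom B (\<lambda>_. N)" "\<forall>h. F h = f (pt B UNIV h)"
    "g \<in> mhom B (\<lambda>_. N)" "\<forall>h. G h = g (pt B UNIV h)"
    using assms by (auto simp: aff_poly_def)
  then show ?thesis unfolding aff_poly_def by (intro CollectI bexI[OF _ mhom_add[of g _ _ f]]) auto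
qed

lemma aff_poly_mult:
  assumes "F \<in> aff_poly B M" "G \<in> aff_poly B N"
  shows "(\<lambda>h. F h * G h) \<in> aff_poly B (M + N)"
proof -
  obtain f g where "f \<in> mhom B (\<lambda>_. M)" "\<forall>h. F h = f (pt B UNIV h)"
    "g \<in> mhom B (\<lambda>_. N)" "\<forall>h. G h = g (pt B UNIV h)"
    using assms by (auto simp: aff_poly_def)
  then show ?thesis
    unfolding aff_poly_def by (intro CollectI bexI[OF _ mhom_mult[of g B "\<lambda>_. N" f "\<lambda>_. M"]]) auto
qed

lemma aff_poly_mono:
  assumes "F \<in> aff_poly B M" "M \<le> N"
  shows "F \<in> aff_poly B N"
  using aff_poly_mult[OF assms(1) aff_poly_const[of 1 B "N - M"]] assms(2) by simp

lemma aff_poly_scale: "F \<in> aff_poly B N \<Longrightarrow> (\<lambda>h. c * F h) \<in> aff_poly B N"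
  using aff_poly_mult[OF aff_poly_const[of c B 0], of F N] by simp

lemma aff_poly_power: "F \<in> aff_poly B N \<Longrightarrow> (\<lambda>h. F h ^ k) \<in> aff_poly B (k * N)"
proof (induction k)
  case (Suc k)
  from aff_poly_mult[OF Suc.prems Suc.IH[OF Suc.prems]] show ?case by simp
qed (simp add: aff_poly_const)

lemma aff_poly_prod:
  assumes "\<And>i. i \<in> I \<Longrightarrow> F i \<in> aff_poly B (N i)"
  shows "(\<lambda>h. \<Prod>i\<in>I. F i h) \<in> aff_poly B (\<Sum>i\<in>I. N i)"
  using assms
proof (induction I rule: infinite_finite_induct)
  case (insert i I)
  then have "(\<lambda>h. F i h * (\<Prod>i\<in>I. F i h)) \<in> aff_poly B (N i + (\<Sum>i\<in>I. N i))"
    by (intro aff_poly_mult) auto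
  with insert show ?case by simp
qed (simp_all add: aff_poly_const)

lemma aff_poly_ev:
  assumes "finite B" "lam \<in> span B"
  shows "ev lam \<in> aff_poly B 1"
  using assms(2)
proof (induction rule: span_induct_alt)
  case base
  have "(\<lambda>h. 0) \<in> aff_poly B 1" by (rule aff_poly_const)
  then show ?case by (simp add: ev_def[abs_def])
next
  case (step c b y)
  \<comment> \<open>The second homogeneous coordinate at \<open>b\<close> and the first at every
    other index of \<open>B\<close>: dehomogenized, this is \<open>ev b\<close>.\<close>
  let ?m = "\<lambda>i. if i \<in> B then if i = b then (0, 1) else (1, 0) else (0, 0 :: nat)"
  have m: "mono_fun B ?m \<in> mhom B (\<lambda>_. 1)" by (rule mhom_monomial) (simp add: has_multideg_def)
  have "ev b h = mono_fun B ?m (pt B UNIV h)" for h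
  proof -
    have "mono_fun B ?m (pt B UNIV h) = (\<Prod>i\<in>B. if i = b then ev b h else 1)"
      unfolding mono_fun_def by (rule prod.cong) (auto simp: hc_pt)
    then show ?thesis using assms(1) step(1) by simp
  qed
  with m have "ev b \<in> aff_poly B 1" unfolding aff_poly_def by (intro CollectI bexI) auto
  then have "(\<lambda>h. complex_of_real c * ev b h + ev y h) \<in> aff_poly B 1"
    using step(2) by (intro aff_poly_add aff_poly_scale)
  moreover have "ev (c *\<^sub>R b + y) = (\<lambda>h. complex_of_real c * ev b h + ev y h)"
    by (simp add: fun_eq_iff ev_add_left ev_scale_left)
  ultimately show ?case by simp
qed

text \<open>On the stratum each finite coordinate is a linear form in the \<open>ev b\<close> and
  each infinite one contributes a constant, so the degrees \<open>e lam\<close> add up to a bound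
  for every variable.\<close>

lemma mhom_pt_aff_poly:
  assumes "f \<in> mhom P e" "finite B" "Psi \<subseteq> span B"
  shows "(\<lambda>h. f (pt P Psi h)) \<in> aff_poly B (\<Sum>lam\<in>P. e lam)"
  using assms(1)
proof (induction rule: mhom_induct)
  case zero
  show ?case by (rule aff_poly_const)
next
  case (add f c m)
  have factor: "(\<lambda>h. fst (hc (pt P Psi h lam)) ^ fst (m lam) * snd (hc (pt P Psi h lam)) ^ snd (m lam))
      \<in> aff_poly B (e lam)" if lam: "lam \<in> P" for lam
  proof (cases "lam \<in> Psi")
    case True
    then have "ev lam \<in> aff_poly B 1" using assms(2,3) by (intro aff_poly_ev) auto
    moreover have "snd (m lam) * 1 \<le> e lam"
      using add(2) lam by (auto simp: has_multideg_def)
    ultimately have "(\<lambda>h. ev lam h ^ snd (m lam)) \<in> aff_poly B (e lam)"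
      by (rule aff_poly_mono[OF aff_poly_power])
    then show ?thesis using True lam by (simp add: hc_pt)
  next
    case False
    then show ?thesis using lam by (simp add: hc_pt aff_poly_const)
  qed
  have "(\<lambda>h. mono_fun P m (pt P Psi h)) \<in> aff_poly B (\<Sum>lam\<in>P. e lam)"
    unfolding mono_fun_def by (rule aff_poly_prod) (rule factor)
  from aff_poly_add[OF add(1) aff_poly_scale[OF this]] show ?case .
qed

text \<open>With the degree fixed at \<open>N\<close>, the second exponent determines the first,
  leaving \<open>N + 1\<close> choices for each index.\<close>

lemma has_multideg_finite_card:
  assumes "finite B"
  shows "finite {m. has_multideg B (\<lambda>_. N) m}" "card {m. has_multideg B (\<lambda>_. N) m} \<le> (N + 1) ^ card B"
proof -
  let ?r = "\<lambda>k i. if i \<in> B then (N - k i, k i) else (0, 0 :: nat)"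
  let ?K = "PiE B (\<lambda>_. {..N})"
  have sub: "{m. has_multideg B (\<lambda>_. N) m} \<subseteq> ?r ` ?K"
  proof
    fix m assume "m \<in> {m. has_multideg B (\<lambda>_. N) m}"
    then have m: "\<And>i. i \<in> B \<Longrightarrow> fst (m i) + snd (m i) = N" "\<And>i. i \<notin> B \<Longrightarrow> m i = (0, 0)"
      by (auto simp: has_multideg_def)
    define k where "k = restrict (\<lambda>i. snd (m i)) B"
    have "m i = ?r k i" for i
      using m(1)[of i] m(2)[of i] by (cases "m i") (auto simp: k_def)
    then have "m = ?r k" by (rule ext)
    moreover have "snd (m i) \<le> N" if "i \<in> B" for i using m(1)[OF that] by linarith
    then have "k \<in> ?K" by (auto simp: k_def)
    ultimately show "m \<in> ?r ` ?K" by (rule image_eqI)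
  qed
  have finK: "finite ?K" using assms by (intro finite_PiE) auto
  show "finite {m. has_multideg B (\<lambda>_. N) m}" using sub finK by (meson finite_imageI finite_subset)
  have "card {m. has_multideg B (\<lambda>_. N) m} \<le> card (?r ` ?K)"
    using sub finK by (intro card_mono) auto
  also have "\<dots> \<le> card ?K" by (rule card_image_le[OF finK])
  also have "\<dots> = (N + 1) ^ card B" using assms by (simp add: card_PiE)
  finally show "card {m. has_multideg B (\<lambda>_. N) m} \<le> (N + 1) ^ card B" .
qed

lemma aff_poly_lin_indep_card:
  assumes "finite B" "finite J" "\<And>j. j \<in> J \<Longrightarrow> F j \<in> aff_poly B N" "lin_indep_on UNIV J F"
  shows "card J \<le> (N + 1) ^ card B"
proof -
  let ?M = "{m. has_multideg B (\<lambda>_. N) m}"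
  have fin: "finite ?M" using has_multideg_finite_card[OF assms(1)] by blast
  have "card J \<le> card ?M"
  proof (rule lin_indep_on_card_le[OF assms(2) fin assms(4)])
    fix j assume "j \<in> J"
    then obtain g where g: "g \<in> mhom B (\<lambda>_. N)" "\<And>h. F j h = g (pt B UNIV h)"
      using assms(3) by (auto simp: aff_poly_def)
    then obtain cf where cf: "g = peval B cf" "multihom B cf (\<lambda>_. N)" by (auto simp: mhom_def)
    then have "{m. cf m \<noteq> 0} \<subseteq> ?M" by (auto simp: multihom_iff)
    from peval_eq_sum[OF fin this]
    show "\<exists>a. \<forall>h. F j h = (\<Sum>m\<in>?M. a m * mono_fun B m (pt B UNIV h))"
      using g cf by auto
  qed
  also have "\<dots> \<le> (N + 1) ^ card B" using has_multideg_finite_card[OF assms(1)] by blast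
  finally show ?thesis .
qed

section \<open>Comparison of growth rates and the dimension of a stratum\<close>

lemma power_le_linear_power_imp_le:
  fixes C m n :: nat
  assumes "\<And>K. (K + 1) ^ n \<le> (C * (K + 1)) ^ m"
  shows "n \<le> m"
proof (rule ccontr)
  assume "\<not> n \<le> m"
  then have "m + 1 \<le> n" by simp
  \<comment> \<open>Large enough for the surplus factor \<open>K + 1\<close> on the left to exceed
    the constant \<open>C ^ m\<close> on the right.\<close>
  define K where "K = C ^ m"
  have "(K + 1) ^ m * (K + 1) = (K + 1) ^ (m + 1)" by simp
  also have "\<dots> \<le> (K + 1) ^ n" using \<open>m + 1 \<le> n\<close> by (intro power_increasing) auto
  also have "\<dots> \<le> (K + 1) ^ m * C ^ m" using assms[of K] by (simp only: power_mult_distrib mult.commute)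
  finally show False by (simp add: K_def)
qed

text \<open>The chain yields \<open>(K + 1) ^ n\<close> independent functions, while polynomials in
  \<open>rk Psi\<close> variables of degree linear in \<open>K\<close> span a space of dimension at
  most a constant times \<open>(K + 1) ^ rk Psi\<close>.\<close>

lemma chain_length_le_rk:
  fixes P :: "(real^'n::finite) set"
  assumes "finite P"
    and Z: "\<forall>k\<le>n. zariski_closed P (Z k) \<and> zariski_irreducible P (Z k)
      \<and> Z k \<subseteq> zariski_closure P (stratum P Psi)"
    and "\<forall>k<n. Z k \<subset> Z (Suc k)"
  shows "n \<le> rk Psi"
proof -
  obtain B where B: "B \<subseteq> Psi" "independent B" "Psi \<subseteq> span B" "card B = dim Psi"
    using basis_exists[of Psi] by blast
  have finB: "finite B" using B(2) by (rule independent_imp_finite)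
  obtain T where T: "\<And>K. \<exists>(J :: nat set) h E. finite J \<and> card J = (K + 1) ^ n \<and> (\<forall>i\<in>P. E i \<le> K * T)
    \<and> (\<forall>j\<in>J. h j \<in> mhom P E) \<and> lin_indep_on (Z n) J h"
    using chain_lin_indep[of P n Z] assms by auto
  have "(K + 1) ^ n \<le> ((card P * T + 1) * (K + 1)) ^ rk Psi" for K
  proof -
    obtain J :: "nat set" and h E where J: "finite J" "card J = (K + 1) ^ n" "\<forall>i\<in>P. E i \<le> K * T"
      "\<forall>j\<in>J. h j \<in> mhom P E" "lin_indep_on (Z n) J h" using T[of K] by auto
    let ?N = "card P * (K * T)"
    \<comment> \<open>Independence passes from \<open>Z n\<close> to the stratum because a
      combination vanishing on the stratum vanishes on its closure.\<close>
    have "lin_indep_on UNIV J (\<lambda>j v. h j (pt P Psi v))"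
      unfolding lin_indep_on_def
    proof (intro allI impI)
      fix c assume *: "\<forall>v\<in>UNIV. (\<Sum>j\<in>J. c j * h j (pt P Psi v)) = 0"
      let ?f = "\<lambda>x. \<Sum>j\<in>J. c j * h j x"
      have "?f \<in> mhom P E" using J(4) by (intro mhom_sum mhom_scale) auto
      moreover have "\<forall>a\<in>stratum P Psi. ?f a = 0" using * by (auto simp: stratum_eq_range)
      ultimately have "\<forall>x\<in>zariski_closure P (stratum P Psi). ?f x = 0"
        unfolding zariski_closure_eq[OF stratum_subset_pts] by auto
      then have "\<forall>x\<in>Z n. ?f x = 0" using Z by auto
      then show "\<forall>j\<in>J. c j = 0" using J(5) unfolding lin_indep_on_def by blast
    qed
    moreover have "(\<lambda>v. h j (pt P Psi v)) \<in> aff_poly B ?N" if "j \<in> J" for j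
    proof (rule aff_poly_mono)
      show "(\<lambda>v. h j (pt P Psi v)) \<in> aff_poly B (\<Sum>lam\<in>P. E lam)"
        using J(4) that finB B(3) by (intro mhom_pt_aff_poly) auto
      show "(\<Sum>lam\<in>P. E lam) \<le> ?N" using sum_bounded_above[of P E "K * T"] J(3) by simp
    qed
    ultimately have "card J \<le> (?N + 1) ^ card B"
      using aff_poly_lin_indep_card[OF finB J(1), of "\<lambda>j v. h j (pt P Psi v)"] by blast
    also have "card B = rk Psi" using B(4) by (simp add: rk_def)
    also have "(?N + 1) ^ rk Psi \<le> ((card P * T + 1) * (K + 1)) ^ rk Psi"
      by (intro power_mono) (auto simp: algebra_simps)
    finally show ?thesis using J(2) by simp
  qed
  then show ?thesis by (rule power_le_linear_power_imp_le)
qed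

text \<open>Closures of the strata along a flag of flats attain the bound of
  \<open>chain_length_le_rk\<close>. The assumption \<open>determined\<close> makes these closures
  strictly increasing, since strata only see the roots in \<open>P\<close>.\<close>

lemma zariski_dim_stratum:
  fixes Phi P :: "(real^'n::finite) set"
  assumes "finite Phi" "P \<subseteq> Phi" "flat Phi Psi"
    and determined: "\<And>A B. flat Phi A \<Longrightarrow> flat Phi B \<Longrightarrow> P \<inter> A \<subseteq> B \<Longrightarrow> A \<subseteq> B"
  shows "zariski_dim P (stratum P Psi) = rk Psi"
proof -
  have finP: "finite P" using assms(1,2) finite_subset by blast
  let ?X = "{n. \<exists>Z :: nat \<Rightarrow> (real^'n \<Rightarrow> complex option) set.
      (\<forall>k\<le>n. zariski_closed P (Z k) \<and> zariski_irreducible P (Z k) \<and> Z k \<subseteq> zariski_closure P (stratum P Psi))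
      \<and> (\<forall>k<n. Z k \<subset> Z (Suc k))}"
  obtain Q where Q: "Q (rk Psi) = Psi" "\<forall>k\<le>rk Psi. flat Phi (Q k)" "\<forall>k<rk Psi. Q k \<subset> Q (Suc k)"
    using flat_chain[OF assms(3)] by blast
  define Z where "Z k = zariski_closure P (stratum P (Q k))" for k
  have le: "zariski_closure P (stratum P A) \<subseteq> zariski_closure P (stratum P B)"
    if "flat Phi A" "A \<subseteq> B" for A B
    using stratum_subset_closure[OF assms(1,2) that]
      zariski_closure_minimal zariski_closed_closure[OF stratum_subset_pts] by blast
  have strict: "Z k \<subset> Z (Suc k)" if k: "k < rk Psi" for k
  proof -
    have flats: "flat Phi (Q k)" "flat Phi (Q (Suc k))" "Q k \<subset> Q (Suc k)" using Q k by auto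
    have "\<not> Z (Suc k) \<subseteq> Z k"
    proof
      assume "Z (Suc k) \<subseteq> Z k"
      then have "stratum P (Q (Suc k)) \<subseteq> zariski_closure P (stratum P (Q k))"
        using zariski_closure_superset unfolding Z_def by blast
      from stratum_subset_closure_imp[OF finP this] determined[OF flats(2,1)] flats(3)
      show False by blast
    qed
    then show ?thesis using le[OF flats(1)] flats(3) unfolding Z_def by blast
  qed
  have QPsi: "Q k \<subseteq> Psi" if "k \<le> rk Psi" for k
    using that
  proof (induction rule: inc_induct)
    case base
    then show ?case using Q(1) by simp
  next
    case (step k)
    then show ?case using Q(3) by blast
  qed
  have "rk Psi \<in> ?X"
  proof (intro CollectI exI[of _ Z] conjI allI impI)
    fix k assume k: "k \<le> rk Psi"
    show "zariski_closed P (Z k)" unfolding Z_def by (rule zariski_closed_closure[OF stratum_subset_pts])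
    show "zariski_irreducible P (Z k)" unfolding Z_def by (rule irreducible_closure_stratum)
    show "Z k \<subseteq> zariski_closure P (stratum P Psi)"
      unfolding Z_def using Q(2) k QPsi[OF k] by (intro le) auto
  qed (rule strict)
  moreover have "n \<le> rk Psi" if "n \<in> ?X" for n
    using that chain_length_le_rk[OF finP] by blast
  \<comment> \<open>The supremum of naturals is meaningful here because the set of chain lengths has
    a largest element.\<close>
  ultimately have "Sup ?X = rk Psi" by (rule cSup_eq_maximum)
  then show ?thesis by (simp only: zariski_dim_def)
qed

section \<open>Weyl group action\<close>

lemma orthogonal_transformation_refl: "orthogonal_transformation (refl a)"
  unfolding orthogonal_transformation_def
proof (intro conjI allI)
  show "linear (refl a)"
    by (rule linearI)
      (simp_all add: refl_def inner_left_distrib algebra_simps add_divide_distrib scaleR_diff_right)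
  show "refl a v \<bullet> refl a w = v \<bullet> w" for v w
    by (cases "a = 0") (simp_all add: refl_def inner_diff_left inner_diff_right inner_commute field_simps)
qed

lemma weyl_orthogonal:
  assumes "w \<in> weyl Phi"
  shows "orthogonal_transformation w"
  using assms
proof induction
  case weyl_id
  show ?case by (simp add: id_def orthogonal_transformation_id)
next
  case (weyl_step w a)
  show ?case
    using orthogonal_transformation_refl weyl_step(3) by (rule orthogonal_transformation_compose)
qed

lemma weyl_image:
  fixes Phi :: "(real^'n::finite) set"
  assumes "root_system Phi" "w \<in> weyl Phi"
  shows "w ` Phi = Phi"
proof -
  have "w ` Phi \<subseteq> Phi"
    using assms(2)
  proof induction
    case (weyl_step w a)
    then show ?case using assms(1) by (auto simp: root_system_def)
  qed simp
  moreover have "inj_on w Phi"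
    using orthogonal_transformation_inj[OF weyl_orthogonal[OF assms(2)]] by (rule inj_on_subset) simp
  moreover have "finite Phi" using assms(1) by (simp add: root_system_def)
  ultimately show ?thesis by (simp add: endo_inj_surj)
qed

text \<open>The matrix of \<open>w\<close> is real, so its complexification acts separately on real
  and imaginary parts.\<close>

lemma hact_eq:
  assumes "linear w"
  shows "hact w h = cpx (w (\<chi> i. Re (h $ i))) + \<i> *s cpx (w (\<chi> i. Im (h $ i)))"
proof -
  have w: "w v $ i = (\<Sum>j\<in>UNIV. v $ j * w (axis j 1) $ i)" for v i
  proof -
    have "v = (\<Sum>j\<in>UNIV. v $ j *\<^sub>R axis j 1)"
      using basis_expansion[of v] by (simp add: scalar_mult_eq_scaleR)
    then have "w v = (\<Sum>j\<in>UNIV. v $ j *\<^sub>R w (axis j 1))"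
      using linear_sum[OF assms] linear_cmul[OF assms] by (metis (no_types, lifting) sum.cong)
    then show ?thesis by simp
  qed
  show ?thesis
    by (simp add: hact_def cpx_def vec_eq_iff complex_eq_iff w[of "\<chi> i. Re (h $ i)"]
        w[of "\<chi> i. Im (h $ i)"] mult.commute)
qed

lemma Re_Im_cpx_add:
  "(\<chi> i. Re ((cpx u + \<i> *s cpx v) $ i)) = u" "(\<chi> i. Im ((cpx u + \<i> *s cpx v) $ i)) = v"
  by (simp_all add: cpx_def vec_eq_iff)

text \<open>An orthogonal map equals its own contragredient, so using the matrix of \<open>w\<close>
  on the Cartan subalgebra keeps the pairing with roots invariant.\<close>

lemma ev_hact:
  assumes "orthogonal_transformation w"
  shows "ev (w lam) (hact w h) = ev lam h"
proof -
  have w: "linear w" "\<And>x y. w x \<bullet> w y = x \<bullet> y"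
    using assms by (auto simp: orthogonal_transformation_def)
  show ?thesis
    unfolding hact_eq[OF w(1)]
    by (subst (2) cpx_Re_Im[of h]) (simp add: ev_add_right ev_scale_right w(2))
qed

lemma surj_hact:
  fixes w :: "real^'n::finite \<Rightarrow> real^'n"
  assumes "orthogonal_transformation w"
  shows "surj (hact w)"
proof (rule surjI)
  fix h
  have inv: "orthogonal_transformation (inv w)" using assms by (rule orthogonal_transformation_inv)
  have lin: "linear w" "linear (inv w)" using assms inv by (auto simp: orthogonal_transformation_def)
  have w_inv: "w (inv w v) = v" for v
    using orthogonal_transformation_surj[OF assms] by (rule surj_f_inv_f)
  show "hact w (hact (inv w) h) = h"
    unfolding hact_eq[OF lin(1)] hact_eq[OF lin(2), of h] Re_Im_cpx_add w_inv
    by (rule cpx_Re_Im[symmetric])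
qed

lemma perp_hact:
  fixes w :: "real^'n::finite \<Rightarrow> real^'n"
  assumes "orthogonal_transformation w"
  shows "perp (w ` Psi) = hact w ` perp Psi"
proof
  show "perp (w ` Psi) \<subseteq> hact w ` perp Psi"
  proof
    fix h assume h: "h \<in> perp (w ` Psi)"
    obtain k where k: "h = hact w k" using surj_hact[OF assms] by (metis surjD)
    then have "k \<in> perp Psi" using h by (auto simp: perp_def ev_hact[OF assms])
    then show "h \<in> hact w ` perp Psi" using k by blast
  qed
qed (auto simp: perp_def ev_hact[OF assms])

lemma flat_image:
  fixes w :: "real^'n::finite \<Rightarrow> real^'n"
  assumes "orthogonal_transformation w" "w ` Phi = Phi" "flat Phi Psi"
  shows "flat Phi (w ` Psi)"
proof -
  have "w ` Psi = w ` (Phi \<inter> span Psi)" using assms(3) by (simp add: flat_def)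
  also have "\<dots> = w ` Phi \<inter> w ` span Psi"
    by (rule image_Int[OF orthogonal_transformation_inj[OF assms(1)]])
  also have "w ` span Psi = span (w ` Psi)"
    using assms(1) by (intro linear_span_image[symmetric]) (simp add: orthogonal_transformation_def)
  finally show ?thesis by (simp add: flat_def assms(2))
qed

section \<open>Negation of roots, positive systems and the action on points\<close>

lemma root_system_uminus: "root_system Phi \<Longrightarrow> a \<in> Phi \<Longrightarrow> - a \<in> Phi"
proof -
  assume "root_system Phi" "a \<in> Phi"
  moreover then have "refl a a \<in> Phi" "a \<noteq> 0" by (auto simp: root_system_def)
  ultimately show ?thesis by (simp add: refl_def scaleR_2)
qed

lemma positive_system_cases:
  assumes "root_system Phi" "positive_system Phi P" "a \<in> Phi"
  shows "a \<in> P \<or> - a \<in> P"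
  using assms root_system_uminus[OF assms(1,3)] by (fastforce simp: positive_system_def)

lemma positive_system_subset: "positive_system Phi P \<Longrightarrow> P \<subseteq> Phi"
  by (auto simp: positive_system_def)

lemma flat_uminus:
  assumes "root_system Phi" "flat Phi Psi" "a \<in> Psi"
  shows "- a \<in> Psi"
  using assms root_system_uminus[OF assms(1)] unfolding flat_def by (metis IntD1 IntD2 IntI span_neg)

lemma flat_uminus_iff:
  assumes "root_system Phi" "flat Phi Psi"
  shows "- a \<in> Psi \<longleftrightarrow> a \<in> Psi"
  using flat_uminus[OF assms, of a] flat_uminus[OF assms, of "- a"] by auto

text \<open>Flats are stable under negation, hence determined by their positive roots, the only ones
  visible in the coordinates of a point.\<close>

lemma flat_subset_if_positive:
  assumes "root_system Phi" "positive_system Phi P" "flat Phi A" "flat Phi B" "P \<inter> A \<subseteq> B"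
  shows "A \<subseteq> B"
proof
  fix a assume a: "a \<in> A"
  then have "a \<in> P \<or> - a \<in> P"
    using positive_system_cases[OF assms(1,2)] flat_subset[OF assms(3)] by blast
  then show "a \<in> B"
    using a assms(5) flat_uminus_iff[OF assms(1,3), of a] flat_uminus_iff[OF assms(1,4), of a] by blast
qed

lemma perp_positive:
  assumes "root_system Phi" "positive_system Phi P" "flat Phi Psi"
  shows "perp (P \<inter> Psi) = perp Psi"
proof
  show "perp (P \<inter> Psi) \<subseteq> perp Psi"
  proof
    fix h assume h: "h \<in> perp (P \<inter> Psi)"
    have "ev a h = 0" if a: "a \<in> Psi" for a
    proof -
      have "a \<in> P \<or> - a \<in> P"
        using positive_system_cases[OF assms(1,2)] flat_subset[OF assms(3)] a by blast
      then show ?thesis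
        using h a flat_uminus[OF assms(1,3) a] ev_minus_left[of a h] by (auto simp: perp_def)
    qed
    then show "h \<in> perp Psi" by (simp add: perp_def)
  qed
qed (rule perp_antimono, simp)

text \<open>If \<open>mu\<close>, the preimage of \<open>lam\<close>, is negative, the sign in
  \<open>xval\<close> turns the value at \<open>- mu\<close> into the value at \<open>mu\<close> and
  fixes infinity. Invariance of the pairing does the rest.\<close>

lemma wact_pt:
  fixes Phi P :: "(real^'n::finite) set"
  assumes "root_system Phi" "positive_system Phi P" "flat Phi Psi" "w \<in> weyl Phi"
  shows "wact P w (pt P Psi h) = pt P (w ` Psi) (hact w h)"
proof
  fix lam
  have w: "orthogonal_transformation w" "w ` Phi = Phi"
    using weyl_orthogonal[OF assms(4)] weyl_image[OF assms(1,4)] by auto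
  define mu where "mu = inv w lam"
  have mu: "w mu = lam"
    unfolding mu_def using orthogonal_transformation_surj[OF w(1)] by (rule surj_f_inv_f)
  have img: "lam \<in> w ` Psi \<longleftrightarrow> mu \<in> Psi"
    unfolding mu[symmetric] by (rule inj_image_mem_iff[OF orthogonal_transformation_inj[OF w(1)]])
  have ev: "ev lam (hact w h) = ev mu h" using ev_hact[OF w(1), of mu h] mu by simp
  show "wact P w (pt P Psi h) lam = pt P (w ` Psi) (hact w h) lam"
  proof (cases "lam \<in> P")
    case True
    then have "lam \<in> w ` Phi" using positive_system_subset[OF assms(2)] w(2) by auto
    then have "mu \<in> Phi"
      using orthogonal_transformation_inj[OF w(1)] mu by (auto simp: inj_def)
    then have "mu \<in> P \<or> - mu \<in> P" by (rule positive_system_cases[OF assms(1,2)])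
    then show ?thesis
      using True by (auto simp: wact_def xval_def pt_def img ev ev_minus_left
          flat_uminus_iff[OF assms(1,3)] mu_def[symmetric])
  qed (simp add: wact_def pt_def)
qed

lemma wact_stratum:
  fixes Phi P :: "(real^'n::finite) set"
  assumes "root_system Phi" "positive_system Phi P" "flat Phi Psi" "w \<in> weyl Phi"
  shows "wact P w ` stratum P Psi = stratum P (w ` Psi)"
proof -
  have "wact P w ` stratum P Psi = pt P (w ` Psi) ` range (hact w)"
    by (simp add: stratum_eq_range image_image wact_pt[OF assms])
  then show ?thesis
    using surj_hact[OF weyl_orthogonal[OF assms(4)]] by (simp add: stratum_eq_range)
qed

section \<open>Strata and intersection lattice both indexed by flats\<close>

lemma strata_eq:
  fixes Phi P :: "(real^'n::finite) set"
  assumes "root_system Phi"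
  shows "strata Phi P = stratum P ` Collect (flat Phi)"
proof
  show "stratum P ` Collect (flat Phi) \<subseteq> strata Phi P"
  proof safe
    fix Psi assume Psi: "flat Phi Psi"
    \<comment> \<open>The number of steps is forced to be the corank of the flat.\<close>
    let ?k = "CARD('n) - rk Psi"
    have "rk Psi \<le> CARD('n)" unfolding rk_def by (rule dim_subset_UNIV_cart)
    then have "Psi \<in> kstep_good Phi ?k" using Psi by (simp add: kstep_good_iff_flat[OF assms])
    then show "stratum P Psi \<in> strata Phi P" by (auto simp: strata_def intro!: exI[of _ ?k])
  qed
qed (auto simp: strata_def kstep_good_iff_flat[OF assms])

lemma annihilator_roots_perp:
  fixes Phi :: "(real^'n::finite) set"
  shows "annihilator_roots Phi (perp S) = Phi \<inter> span S"
  by (auto simp: annihilator_roots_def in_span_iff_ev)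

text \<open>Replacing a set of positive roots by the flat it generates leaves its
  \<open>perp\<close> unchanged; conversely the positive roots of a flat already cut out its
  \<open>perp\<close>.\<close>

lemma intersection_lattice_eq:
  fixes Phi P :: "(real^'n::finite) set"
  assumes "root_system Phi" "positive_system Phi P"
  shows "intersection_lattice P = perp ` Collect (flat Phi)"
proof
  have perp: "\<Inter> ((\<lambda>lam. {h. ev lam h = 0}) ` S) = perp S" for S :: "(real^'n) set"
    by (auto simp: perp_def)
  show "intersection_lattice P \<subseteq> perp ` Collect (flat Phi)"
  proof
    fix X assume "X \<in> intersection_lattice P"
    then obtain S where S: "S \<subseteq> P" "X = perp S" by (auto simp: intersection_lattice_def perp)
    then have sub: "S \<subseteq> Phi" using positive_system_subset[OF assms(2)] by blast
    have "X = perp (Phi \<inter> span S)"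
      using S(2) perp_span[of S] perp_span[of "Phi \<inter> span S"] span_Int_span[OF sub] by simp
    then show "X \<in> perp ` Collect (flat Phi)" using flat_Int_span[OF sub] by blast
  qed
  show "perp ` Collect (flat Phi) \<subseteq> intersection_lattice P"
  proof safe
    fix Psi assume "flat Phi Psi"
    then have "perp Psi = perp (P \<inter> Psi)" using perp_positive[OF assms] by simp
    then show "perp Psi \<in> intersection_lattice P"
      unfolding intersection_lattice_def perp by blast
  qed
qed

theorem mainTheorem12:
  fixes Phi P :: "(real^'n::finite) set"
  assumes "root_system Phi"
    and "positive_system Phi P"
  defines "F \<equiv> (\<lambda>X. stratum P (annihilator_roots Phi X))"
  shows "\<exists>G. (\<forall>k Psi. k \<le> CARD('n) \<and> Psi \<in> kstep_good Phi k \<longrightarrow> G (stratum P Psi) = perp Psi)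
    \<and> bij_betw G (strata Phi P) (intersection_lattice P)
    \<and> (\<forall>C\<in>strata Phi P. \<forall>C'\<in>strata Phi P.
          C \<subseteq> zariski_closure P C' \<longleftrightarrow> G C' \<subseteq> G C)
    \<and> (\<forall>C\<in>strata Phi P. zariski_dim P C = codim (G C))
    \<and> (\<forall>X\<in>intersection_lattice P. F X \<in> strata Phi P \<and> G (F X) = X)
    \<and> (\<forall>C\<in>strata Phi P. F (G C) = C)
    \<and> (\<forall>w\<in>weyl Phi. (\<forall>C\<in>strata Phi P. wact P w ` C \<in> strata Phi P
                          \<and> G (wact P w ` C) = hact w ` G C)
                  \<and> (\<forall>X\<in>intersection_lattice P. hact w ` X \<in> intersection_lattice P))"
proof -
  \<comment> \<open>\<open>G\<close> must depend on the stratum alone, so the roots are read off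
    from it: those of \<open>P\<close> whose coordinate is finite at some point of
    \<open>C\<close>.\<close>
  define G where "G C = perp {lam \<in> P. \<exists>x\<in>C. x lam \<noteq> None}"
    for C :: "(real^'n \<Rightarrow> complex option) set"
  note strata = strata_eq[OF assms(1), of P]
  note lattice = intersection_lattice_eq[OF assms(1,2)]
  have finPhi: "finite Phi" using assms(1) by (simp add: root_system_def)
  have PPhi: "P \<subseteq> Phi" using assms(2) by (rule positive_system_subset)
  have finP: "finite P" using finPhi PPhi finite_subset by blast
  have G: "G (stratum P Psi) = perp Psi" if "flat Phi Psi" for Psi
  proof -
    have "{lam \<in> P. \<exists>x\<in>stratum P Psi. x lam \<noteq> None} = P \<inter> Psi"
      by (auto simp: stratum_eq_range pt_def)
    then show ?thesis using perp_positive[OF assms(1,2) that] by (simp add: G_def)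
  qed
  have F: "F (perp Psi) = stratum P Psi" if "flat Phi Psi" for Psi
    using that by (simp add: F_def annihilator_roots_perp flat_def)
  \<comment> \<open>A flat is recovered from its \<open>perp\<close> by
    \<open>annihilator_roots\<close>, so the order reversal is an equivalence.\<close>
  have subset_iff: "A \<subseteq> B \<longleftrightarrow> perp B \<subseteq> perp A" if "flat Phi A" "flat Phi B" for A B
  proof
    assume "perp B \<subseteq> perp A"
    then have "annihilator_roots Phi (perp A) \<subseteq> annihilator_roots Phi (perp B)"
      by (auto simp: annihilator_roots_def)
    with that show "A \<subseteq> B" by (simp add: annihilator_roots_perp flat_def)
  qed (rule perp_antimono)
  have G_kstep: "G (stratum P Psi) = perp Psi" if "Psi \<in> kstep_good Phi k" for k Psi
    using G that by (simp add: kstep_good_iff_flat[OF assms(1)])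
  have bij: "bij_betw G (strata Phi P) (intersection_lattice P)"
    by (rule bij_betw_byWitness[of _ F]) (auto simp: strata lattice F G)
  have order: "C \<subseteq> zariski_closure P C' \<longleftrightarrow> G C' \<subseteq> G C"
    if C: "C \<in> strata Phi P" "C' \<in> strata Phi P" for C C'
  proof -
    obtain A B where AB: "flat Phi A" "C = stratum P A" "flat Phi B" "C' = stratum P B"
      using C by (auto simp: strata)
    \<comment> \<open>The closure relation only compares positive roots; symmetry of flats under
      negation extends this to all of \<open>A\<close>.\<close>
    have "C \<subseteq> zariski_closure P C' \<longleftrightarrow> A \<subseteq> B"
      using stratum_subset_closure[OF finPhi PPhi AB(1)] stratum_subset_closure_imp[OF finP]
        flat_subset_if_positive[OF assms(1,2) AB(1,3)] AB(2,4) by blast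
    then show ?thesis using subset_iff[OF AB(1,3)] AB G by simp
  qed
  have dim: "zariski_dim P C = codim (G C)" if C: "C \<in> strata Phi P" for C
  proof -
    obtain A where A: "flat Phi A" "C = stratum P A" using C by (auto simp: strata)
    then show ?thesis
      using zariski_dim_stratum[OF finPhi PPhi A(1) flat_subset_if_positive[OF assms(1,2)]]
      by (simp add: G codim_perp)
  qed
  have F_lattice: "F X \<in> strata Phi P \<and> G (F X) = X" if "X \<in> intersection_lattice P" for X
    using that by (auto simp: strata lattice F G)
  have F_G: "F (G C) = C" if "C \<in> strata Phi P" for C
    using that by (auto simp: strata F G)
  have wact: "wact P w ` C \<in> strata Phi P \<and> G (wact P w ` C) = hact w ` G C"
    if w: "w \<in> weyl Phi" and C: "C \<in> strata Phi P" for w C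
  proof -
    obtain A where A: "flat Phi A" "C = stratum P A" using C by (auto simp: strata)
    have "flat Phi (w ` A)"
      using weyl_orthogonal[OF w] weyl_image[OF assms(1) w] A(1) by (rule flat_image)
    then show ?thesis
      using A perp_hact[OF weyl_orthogonal[OF w], of A]
      by (simp add: wact_stratum[OF assms(1,2) _ w] G strata)
  qed
  have hact: "hact w ` X \<in> intersection_lattice P"
    if w: "w \<in> weyl Phi" and X: "X \<in> intersection_lattice P" for w X
  proof -
    obtain A where A: "flat Phi A" "X = perp A" using X by (auto simp: lattice)
    have "flat Phi (w ` A)"
      using weyl_orthogonal[OF w] weyl_image[OF assms(1) w] A(1) by (rule flat_image)
    then show ?thesis using A perp_hact[OF weyl_orthogonal[OF w], of A] by (auto simp: lattice)
  qed
  show ?thesis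
    by (rule exI[of _ G], intro conjI allI ballI impI; (elim conjE)?)
      (use bij G_kstep order dim F_lattice F_G wact hact in simp_all)
qed

end
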